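(* Assume (A1) $X$ is $C^\infty$; (A2) $\sigma_{\min}\big[\int_{\mathcal{R}}\frac{\rho}{\Delta t^2}\frac{\partial X}{\partial\theta}(x,\theta_-)^T\frac{\partial X}{\partial\theta}(x,\theta_-)\,dx\big]\ge\sigma_X>0$; (A3) for every $x\in\mathcal{C}$, $\partial^3 v_x/\partial\theta^3$ exists and is continuous. Then there exist $r>0$ and $\alpha_1>0$ such that for every $\alpha\in(0,\alpha_1]$ and every feasible $w$, the negative gradient flow $\dot\theta(t)=-\nabla_\theta V_\alpha(\theta(t),w)$ with $\theta(0)=\theta_-$, where $V_\alpha(\theta,w)=\|G_\alpha(\theta,w)\|^2$, converges to a solution $\theta$ of $G_\alpha(\theta,w)=0$, and this solution lies in the ball $\mathcal{B}(\theta_-,r)$.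
   Context: A configuration is $\theta\in\mathbb{R}^n$; the robot occupies a region $\mathcal{R}\subset\mathbb{R}^3$ with density $\rho>0$; $X(x,\theta)\in\mathbb{R}^3$ is forward kinematics; $\mathcal{C}\subset\mathcal{R}$ is a finite set of contact points; for each $x\in\mathcal{C}$, $v_x:\mathbb{R}^n\to\mathbb{R}^{3\times V_x}$ is a matrix-valued function and $w_x\in\mathbb{R}^{V_x}$; $w$ is the concatenation of the $w_x$, feasible if $w_x\ge0$ and $\mathbf{1}^Tw_x\le1$ for every $x$. Fixed data: $\Delta t>0$, $\theta_-,\theta_{--},\tau\in\mathbb{R}^n$, $\alpha\in(0,1]$. $A(\theta)=\int_{\mathcal{R}}\frac{\rho}{\Delta t^2}\frac{\partial X}{\partial\theta}(x,\theta)^T(X(x,\theta)-X(x,\theta_-))dx$, $B(\theta,w)=\int_{\mathcal{R}}\frac{\rho}{\Delta t^2}\frac{\partial X}{\partial\theta}(x,\theta)^T(X(x,\theta_{--})-X(x,\theta_-))dx-\sum_{x\in\mathcal{C}}\frac{\partial X}{\partial\theta}(x,\theta)^Tv_x(\theta)w_x-\tau$, and $G_\alpha(\theta,w)=\frac1\alpha A(\theta)+B(\theta,w)$. $\mathcal{B}(\theta_-,r)$ is the closed Euclidean ball of radius $r$ around $\theta_-$. *)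

theory Defs
  imports "HOL-Analysis.Analysis"
begin

fun Ck :: "nat \<Rightarrow> ('a::euclidean_space \<Rightarrow> 'b::real_normed_vector) \<Rightarrow> bool" where
  "Ck 0 f = continuous_on UNIV f"
| "Ck (Suc k) f = (\<exists>f'. (\<forall>x. (f has_derivative f' x) (at x)) \<and> (\<forall>h. Ck k (\<lambda>x. f' x h)))"

definition smooth :: "('a::euclidean_space \<Rightarrow> 'b::real_normed_vector) \<Rightarrow> bool" where
  "smooth f \<longleftrightarrow> (\<forall>k. Ck k f)"

definition sigma_min :: "real^'n^'n \<Rightarrow> real" where
  "sigma_min M = Inf {norm (M *v u) | u. norm u = 1}"

definition dXdth :: "(real^3 \<Rightarrow> real^'n \<Rightarrow> real^3) \<Rightarrow> real^3 \<Rightarrow> real^'n \<Rightarrow> real^'n^3" where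
  "dXdth X x th = jacobian (X x) (at th)"

definition Aop :: "(real^3) set \<Rightarrow> real \<Rightarrow> real \<Rightarrow> (real^3 \<Rightarrow> real^'n \<Rightarrow> real^3) \<Rightarrow> real^'n \<Rightarrow> real^'n \<Rightarrow> real^'n" where
  "Aop R \<rho> dt X thp th =
     integral R (\<lambda>x. (\<rho> / dt^2) *\<^sub>R (transpose (dXdth X x th) *v (X x th - X x thp)))"

text \<open>B(theta,w). The matrix v_x(theta) in R^{3 x V_x} is given by its columns
  vcol x j theta (j < V x); w_x is given by its coordinates w x j (j < V x),
  so v_x(theta) w_x = sum_{j<V x} w x j * vcol x j theta.\<close>
definition Bop :: "(real^3) set \<Rightarrow> real \<Rightarrow> real \<Rightarrow> (real^3 \<Rightarrow> real^'n \<Rightarrow> real^3) \<Rightarrow> real^'n \<Rightarrow> real^'n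
     \<Rightarrow> (real^3) set \<Rightarrow> (real^3 \<Rightarrow> nat) \<Rightarrow> (real^3 \<Rightarrow> nat \<Rightarrow> real^'n \<Rightarrow> real^3) \<Rightarrow> real^'n
     \<Rightarrow> real^'n \<Rightarrow> (real^3 \<Rightarrow> nat \<Rightarrow> real) \<Rightarrow> real^'n" where
  "Bop R \<rho> dt X thp thpp C V vcol \<tau> th w =
     integral R (\<lambda>x. (\<rho> / dt^2) *\<^sub>R (transpose (dXdth X x th) *v (X x thpp - X x thp)))
     - (\<Sum>x\<in>C. transpose (dXdth X x th) *v (\<Sum>j<V x. w x j *\<^sub>R vcol x j th))
     - \<tau>"

definition Gop :: "real \<Rightarrow> (real^3) set \<Rightarrow> real \<Rightarrow> real \<Rightarrow> (real^3 \<Rightarrow> real^'n \<Rightarrow> real^3) \<Rightarrow> real^'n \<Rightarrow> real^'n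
     \<Rightarrow> (real^3) set \<Rightarrow> (real^3 \<Rightarrow> nat) \<Rightarrow> (real^3 \<Rightarrow> nat \<Rightarrow> real^'n \<Rightarrow> real^3) \<Rightarrow> real^'n
     \<Rightarrow> real^'n \<Rightarrow> (real^3 \<Rightarrow> nat \<Rightarrow> real) \<Rightarrow> real^'n" where
  "Gop \<alpha> R \<rho> dt X thp thpp C V vcol \<tau> th w =
     (1 / \<alpha>) *\<^sub>R Aop R \<rho> dt X thp th + Bop R \<rho> dt X thp thpp C V vcol \<tau> th w"

definition feasible :: "(real^3) set \<Rightarrow> (real^3 \<Rightarrow> nat) \<Rightarrow> (real^3 \<Rightarrow> nat \<Rightarrow> real) \<Rightarrow> bool" where
  "feasible C V w \<longleftrightarrow> (\<forall>x\<in>C. (\<forall>j<V x. 0 \<le> w x j) \<and> (\<Sum>j<V x. w x j) \<le> 1)"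

definition neg_grad_flow :: "(real^'n \<Rightarrow> real) \<Rightarrow> real^'n \<Rightarrow> (real \<Rightarrow> real^'n) \<Rightarrow> bool" where
  "neg_grad_flow Vf th0 \<gamma> \<longleftrightarrow> \<gamma> 0 = th0 \<and>
     (\<forall>t\<ge>0. \<exists>g. (Vf has_derivative (\<lambda>h. g \<bullet> h)) (at (\<gamma> t)) \<and>
                 (\<gamma> has_vector_derivative (- g)) (at t within {0..}))"

end

theory Submission
  imports Defs
begin

text \<open>
  Write \<open>G = A / \<alpha> + B\<close>. Since \<open>A\<close> vanishes at \<open>\<theta>\<^sub>-\<close> and its derivative there is the Gram matrix of
  assumption (A2), on a small ball the adjoint of \<open>DG\<close> is bounded below by \<open>m = \<sigma> / (2 \<alpha>)\<close> and above
  by \<open>N / \<alpha>\<close>, while \<open>K\<close> bounds \<open>\<parallel>G(\<theta>\<^sub>-)\<parallel>\<close> uniformly in \<open>\<alpha>\<close> and \<open>w\<close>. Along the flow the lower bound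
  gives \<open>\<parallel>G\<parallel> \<le> K exp (- 2 m\<^sup>2 t)\<close>, so by the upper bound the speed decays exponentially and the total
  displacement is at most \<open>(N / \<alpha>) K / m\<^sup>2 = O(\<alpha>)\<close>. For small \<open>\<alpha>\<close> the trajectory therefore never
  reaches the boundary of the ball, and it converges to a zero of \<open>G\<close>.
\<close>

section \<open>Calculus of \<open>C\<^sup>k\<close> maps\<close>

lemma Ck_Suc_imp_Ck: "Ck (Suc k) f \<Longrightarrow> Ck k f"
proof (induction k arbitrary: f)
  case 0
  then show ?case
    by (auto intro!: differentiable_imp_continuous_on simp: differentiable_on_def differentiable_def)
      (metis has_derivative_at_withinI)
next
  case (Suc k)
  from Suc.prems obtain f' where "\<forall>x. (f has_derivative f' x) (at x)" "\<forall>h. Ck (Suc k) (\<lambda>x. f' x h)"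
    by (auto simp only: Ck.simps(2)[of "Suc k"])
  with Suc.IH show ?case by (subst Ck.simps(2)) blast
qed

lemma Ck_mono: "Ck n f \<Longrightarrow> m \<le> n \<Longrightarrow> Ck m f"
  by (induction n) (auto simp: le_Suc_eq simp del: Ck.simps dest: Ck_Suc_imp_Ck)

lemma Ck_imp_continuous_on: "Ck k f \<Longrightarrow> continuous_on S f"
  using Ck_mono[of k f 0] continuous_on_subset by force

lemma Ck_SucI:
  assumes "\<And>x. (f has_derivative f' x) (at x)" "\<And>h. Ck k (\<lambda>x. f' x h)"
  shows "Ck (Suc k) f"
  using assms by (subst Ck.simps) blast

text \<open>Uniqueness of derivatives lets the existential witness inside \<open>Ck\<close> be
  exchanged for any derivative already at hand, so one family \<open>f'\<close> can be fixed and
  then shown regular to every order.\<close>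

lemma Ck_SucD:
  assumes "Ck (Suc k) f" "\<And>x. (f has_derivative f' x) (at x)"
  shows "Ck k (\<lambda>x. f' x h)"
proof -
  obtain g where g: "\<forall>x. (f has_derivative g x) (at x)" "\<forall>h. Ck k (\<lambda>x. g x h)"
    using assms(1) by (subst (asm) Ck.simps) blast
  have "g = f'"
    using g(1) assms(2) has_derivative_unique by blast
  then show ?thesis using g by blast
qed

lemma Ck_SucE:
  assumes "Ck (Suc k) f"
  obtains f' where "\<And>x. (f has_derivative f' x) (at x)" "\<And>h. Ck k (\<lambda>x. f' x h)"
  using assms by (subst (asm) Ck.simps) blast

lemma Ck_const: "Ck k (\<lambda>x. c)"
proof (induction k arbitrary: c)
  case (Suc k)
  show ?case by (rule Ck_SucI[where f' = "\<lambda>x h. 0"]) (auto intro: Suc.IH)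
qed simp

lemma Ck_add:
  assumes "Ck k f" "Ck k g"
  shows "Ck k (\<lambda>x. f x + g x)"
  using assms
proof (induction k arbitrary: f g)
  case 0
  then show ?case by (auto intro: continuous_intros)
next
  case (Suc k)
  obtain f' where f: "\<And>x. (f has_derivative f' x) (at x)" "\<And>h. Ck k (\<lambda>x. f' x h)"
    using Suc.prems(1) by (rule Ck_SucE) (rule that)
  obtain g' where g: "\<And>x. (g has_derivative g' x) (at x)" "\<And>h. Ck k (\<lambda>x. g' x h)"
    using Suc.prems(2) by (rule Ck_SucE) (rule that)
  show ?case
    by (rule Ck_SucI[where f' = "\<lambda>x h. f' x h + g' x h"])
       (auto intro!: f g Suc.IH has_derivative_add)
qed

lemma Ck_sum:
  assumes "\<And>i. i \<in> I \<Longrightarrow> Ck k (f i)"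
  shows "Ck k (\<lambda>x. \<Sum>i\<in>I. f i x)"
  using assms by (induction I rule: infinite_finite_induct) (auto intro: Ck_const Ck_add)

text \<open>The product rule yields two terms of the same bilinear shape, so the induction closes
  once \<open>f\<close> and \<open>g\<close> themselves are lowered to order \<open>k\<close>.
  Scalings and inner products, from which the integrands and the gradient field are assembled, are
  both instances.\<close>

lemma Ck_bilinear:
  assumes B: "bounded_bilinear B" and "Ck k f" "Ck k g"
  shows "Ck k (\<lambda>x. B (f x) (g x))"
  using assms(2,3)
proof (induction k arbitrary: f g)
  case 0
  then show ?case by (auto intro: bounded_bilinear.continuous_on[OF B])
next
  case (Suc k)
  obtain f' where f: "\<And>x. (f has_derivative f' x) (at x)" "\<And>h. Ck k (\<lambda>x. f' x h)"
    using Suc.prems(1) by (rule Ck_SucE) (rule that)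
  obtain g' where g: "\<And>x. (g has_derivative g' x) (at x)" "\<And>h. Ck k (\<lambda>x. g' x h)"
    using Suc.prems(2) by (rule Ck_SucE) (rule that)
  show ?case
  proof (rule Ck_SucI)
    show "((\<lambda>x. B (f x) (g x)) has_derivative (\<lambda>h. B (f x) (g' x h) + B (f' x h) (g x))) (at x)" for x
      using f(1) g(1) by (rule bounded_bilinear.FDERIV[OF B])
    show "Ck k (\<lambda>x. B (f x) (g' x h) + B (f' x h) (g x))" for h
      using f(2) g(2) Suc.prems[THEN Ck_Suc_imp_Ck] by (intro Ck_add Suc.IH)
  qed
qed

lemmas Ck_scaleR = Ck_bilinear[OF bounded_bilinear_scaleR]
lemmas Ck_inner = Ck_bilinear[OF bounded_bilinear_inner]

lemma Ck_diff:
  assumes "Ck k f" "Ck k g"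
  shows "Ck k (\<lambda>x. f x - g x)"
  using Ck_add[OF assms(1) Ck_scaleR[OF Ck_const assms(2), of "-1"]] by simp

text \<open>For an affine inner map the derivative of the composition is \<open>f'\<close> in the
  fixed direction \<open>L h\<close>, so the induction hypothesis applies directly. The purpose is
  to freeze one argument of a function on pairs.\<close>

lemma Ck_compose_affine:
  assumes L: "bounded_linear L" and "Ck k f"
  shows "Ck k (\<lambda>y. f (c + L y))"
  using assms(2)
proof (induction k arbitrary: f)
  case 0
  then show ?case
    by (auto intro!: continuous_on_compose2[of UNIV f] continuous_on_add continuous_on_const
        linear_continuous_on[OF L])
next
  case (Suc k)
  obtain f' where f: "\<And>x. (f has_derivative f' x) (at x)" "\<And>h. Ck k (\<lambda>x. f' x h)"
    using Suc.prems by (rule Ck_SucE) (rule that)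
  show ?case
  proof (rule Ck_SucI[where f' = "\<lambda>y h. f' (c + L y) (L h)"])
    fix y
    have "((\<lambda>y. c + L y) has_derivative L) (at y)"
      using has_derivative_add[OF has_derivative_const bounded_linear_imp_has_derivative[OF L]] by simp
    then show "((\<lambda>y. f (c + L y)) has_derivative (\<lambda>h. f' (c + L y) (L h))) (at y)"
      using f(1) by (rule has_derivative_compose)
  next
    show "Ck k (\<lambda>x. f' (c + L x) (L h))" for h
      by (rule Suc.IH[OF f(2)])
  qed
qed

section \<open>Uniform derivative bounds from continuity in each direction\<close>

lemma norm_linear_le_sum_Basis:
  fixes f :: "'a::euclidean_space \<Rightarrow> 'b::real_normed_vector"
  assumes "linear f"
  shows "norm (f h) \<le> (\<Sum>b\<in>Basis. norm (f b)) * norm h"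
proof -
  have "f h = f (\<Sum>b\<in>Basis. (h \<bullet> b) *\<^sub>R b)" by (simp add: euclidean_representation)
  also have "\<dots> = (\<Sum>b\<in>Basis. (h \<bullet> b) *\<^sub>R f b)"
    by (simp add: linear_sum[OF assms] linear_scale[OF assms])
  also have "norm \<dots> \<le> (\<Sum>b\<in>Basis. norm (f b) * norm h)"
    by (rule sum_norm_le) (simp add: Basis_le_norm mult.commute[of "norm (f _)"] mult_right_mono)
  finally show ?thesis by (simp add: sum_distrib_right)
qed

text \<open>\<open>Ck\<close> speaks of one direction at a time. Summing the norms over the finite
  basis gives a continuous function of the base point that dominates the operator norm, and this sum
  is bounded on a compact set.\<close>

lemma derivative_bounded_on_compact:
  fixes f :: "'a::euclidean_space \<Rightarrow> 'b::real_normed_vector"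
  assumes f: "\<And>x. (f has_derivative f' x) (at x)" "\<And>h. continuous_on UNIV (\<lambda>x. f' x h)"
    and S: "compact S"
  obtains B where "B > 0" "\<And>x h. x \<in> S \<Longrightarrow> norm (f' x h) \<le> B * norm h"
proof -
  have "continuous_on S (\<lambda>x. \<Sum>b\<in>Basis. norm (f' x b))"
    using continuous_on_subset[OF f(2)] by (auto intro!: continuous_intros)
  then have "bounded ((\<lambda>x. \<Sum>b\<in>Basis. norm (f' x b)) ` S)"
    using S compact_continuous_image compact_imp_bounded by blast
  then obtain B where B: "B > 0" "\<And>x. x \<in> S \<Longrightarrow> norm (\<Sum>b\<in>Basis. norm (f' x b)) \<le> B"
    unfolding bounded_pos by blast
  have "norm (f' x h) \<le> B * norm h" if "x \<in> S" for x h
  proof -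
    have "norm (f' x h) \<le> (\<Sum>b\<in>Basis. norm (f' x b)) * norm h"
      by (rule norm_linear_le_sum_Basis[OF has_derivative_linear[OF f(1)]])
    also have "\<dots> \<le> B * norm h"
      using B(2)[OF that] by (intro mult_right_mono) auto
    finally show ?thesis .
  qed
  with B(1) that show ?thesis by blast
qed

text \<open>The summed deviation over the basis is continuous and vanishes at \<open>a\<close>,
  hence is below \<open>e\<close> on an open ball; halving its radius leaves a closed one.\<close>

lemma derivative_close_on_cball:
  fixes f :: "'a::euclidean_space \<Rightarrow> 'b::real_normed_vector"
  assumes f: "\<And>x. (f has_derivative f' x) (at x)" "\<And>h. continuous_on UNIV (\<lambda>x. f' x h)"
    and e: "e > 0"
  obtains r where "r > 0" "\<And>x h. x \<in> cball a r \<Longrightarrow> norm (f' x h - f' a h) \<le> e * norm h"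
proof -
  let ?g = "\<lambda>x. \<Sum>b\<in>Basis. norm (f' x b - f' a b)"
  have "continuous_on UNIV ?g"
    by (intro continuous_intros f)
  then obtain d where d: "d > 0" "\<And>x. dist x a < d \<Longrightarrow> dist (?g x) (?g a) < e"
    using e unfolding continuous_on_iff by blast
  have "norm (f' x h - f' a h) \<le> e * norm h" if "x \<in> cball a (d / 2)" for x h
  proof -
    have "dist x a < d" using that d(1) by (simp add: dist_commute)
    then have le: "?g x \<le> e" using d(2)[of x] by (simp add: dist_real_def)
    have "linear (\<lambda>h. f' x h - f' a h)"
      by (intro linear_compose_sub has_derivative_linear[OF f(1)])
    from norm_linear_le_sum_Basis[OF this, of h]
    have "norm (f' x h - f' a h) \<le> ?g x * norm h" .
    also have "\<dots> \<le> e * norm h"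
      using le by (intro mult_right_mono) auto
    finally show ?thesis .
  qed
  then show ?thesis using that[of "d/2"] d(1) by auto
qed

text \<open>This is the mean value inequality: compactness bounds the derivative, convexity keeps
  segments inside \<open>S\<close>.\<close>

lemma Ck_lipschitz_on_compact_convex:
  fixes f :: "'a::euclidean_space \<Rightarrow> 'b::euclidean_space"
  assumes "Ck (Suc k) f" "compact S" "convex S"
  obtains L where "L-lipschitz_on S f"
proof -
  obtain f' where f: "\<And>x. (f has_derivative f' x) (at x)" "\<And>h. Ck k (\<lambda>x. f' x h)"
    using assms(1) by (rule Ck_SucE) (rule that)
  then obtain B where B: "B > 0" "\<And>x h. x \<in> S \<Longrightarrow> norm (f' x h) \<le> B * norm h"
    using derivative_bounded_on_compact[of f f' S] Ck_imp_continuous_on assms(2) by metis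
  have "B-lipschitz_on S f"
  proof (rule lipschitz_onI)
    fix x y assume "x \<in> S" "y \<in> S"
    then show "dist (f x) (f y) \<le> B * dist x y"
      unfolding dist_norm using assms(3) B
      by (intro differentiable_bound[of S f f' B])
         (auto intro: has_derivative_at_withinI f onorm_le)
  qed (use B in auto)
  then show ?thesis by (rule that)
qed

section \<open>Integrals depending on a parameter\<close>

lemma integrable_on_bounded_continuous:
  fixes g :: "'a::euclidean_space \<Rightarrow> 'c::euclidean_space"
  assumes R: "bounded R" "R \<in> sets lebesgue" and g: "continuous_on UNIV g"
  shows "g integrable_on R"
proof -
  have lm: "R \<in> lmeasurable" using R by (rule bounded_set_imp_lmeasurable)
  have "compact (closure R)" using R(1) by simp
  then have "bounded (g ` closure R)"
    using compact_continuous_image[OF continuous_on_subset[OF g subset_UNIV]] compact_imp_bounded by blast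
  then obtain B where "\<And>x. x \<in> closure R \<Longrightarrow> norm (g x) \<le> B"
    unfolding bounded_iff by blast
  then have "\<And>x. x \<in> R \<Longrightarrow> norm (g x) \<le> B"
    using closure_subset by blast
  moreover have "g \<in> borel_measurable (lebesgue_on R)"
    using continuous_on_subset[OF g subset_UNIV] R(2) by (rule continuous_imp_measurable_on_sets_lebesgue)
  moreover have "(\<lambda>_. B) integrable_on R"
    using lm by (rule integrable_on_const)
  ultimately show ?thesis
    using R(2) by (metis measurable_bounded_by_integrable_imp_integrable)
qed

lemma norm_integral_le_const:
  fixes g :: "'a::euclidean_space \<Rightarrow> 'c::euclidean_space"
  assumes R: "bounded R" "R \<in> sets lebesgue" and "g integrable_on R" "\<And>x. x \<in> R \<Longrightarrow> norm (g x) \<le> B"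
  shows "norm (integral R g) \<le> B * measure lebesgue R"
proof -
  have lm: "R \<in> lmeasurable" using R by (rule bounded_set_imp_lmeasurable)
  have "norm (integral R g) \<le> integral R (\<lambda>_. B)"
    using assms lm by (intro integral_norm_bound_integral integrable_on_const) auto
  also have "\<dots> = B * integral R (\<lambda>_. 1)"
    using integral_mult_right[of R B "\<lambda>_. 1"] by simp
  finally show ?thesis using lm by (simp add: lmeasure_integral)
qed

lemma continuous_on_slice: "continuous_on UNIV f \<Longrightarrow> continuous_on S (\<lambda>x. f (x, y))"
  by (rule continuous_on_compose2[of UNIV f]) (auto intro!: continuous_intros)

text \<open>Uniform continuity on the compact set \<open>closure R \<times> cball a 1\<close> gives
  a single \<open>d\<close> for all \<open>x\<close> in \<open>R\<close>. The radius 1 is arbitrary;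
  \<open>min d 1\<close> keeps \<open>y\<close> in that ball.\<close>

lemma continuous_slices_uniformly_close:
  fixes f :: "'a::euclidean_space \<times> 'b::euclidean_space \<Rightarrow> 'c::metric_space"
  assumes R: "bounded R" and f: "continuous_on UNIV f" and e: "e > 0"
  obtains d where "d > 0" "\<And>x y. x \<in> R \<Longrightarrow> dist y a < d \<Longrightarrow> dist (f (x, y)) (f (x, a)) < e"
proof -
  let ?K = "closure R \<times> cball a 1"
  have "compact ?K" using R by (intro compact_Times) auto
  then have "uniformly_continuous_on ?K f"
    using f continuous_on_subset by (blast intro: compact_uniformly_continuous)
  then obtain d where d: "d > 0" "\<And>p q. p \<in> ?K \<Longrightarrow> q \<in> ?K \<Longrightarrow> dist q p < d \<Longrightarrow> dist (f q) (f p) < e"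
    using e unfolding uniformly_continuous_on_def by meson
  have "dist (f (x, y)) (f (x, a)) < e" if "x \<in> R" "dist y a < min d 1" for x y
    using that closure_subset[of R] by (intro d(2)) (auto simp: dist_Pair_Pair dist_commute)
  then show ?thesis using that[of "min d 1"] d(1) by auto
qed

lemma continuous_on_parametric_integral:
  fixes f :: "'a::euclidean_space \<times> 'b::euclidean_space \<Rightarrow> 'c::euclidean_space"
  assumes R: "bounded R" "R \<in> sets lebesgue" and f: "continuous_on UNIV f"
  shows "continuous_on UNIV (\<lambda>y. integral R (\<lambda>x. f (x, y)))"
  unfolding continuous_on_iff
proof (intro ballI allI impI)
  fix a :: 'b and e :: real
  assume e: "e > 0"
  define \<mu> where "\<mu> = measure lebesgue R"
  have \<mu>: "\<mu> \<ge> 0" by (simp add: \<mu>_def)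
  \<comment> \<open>The summand 1 keeps the quotient meaningful when \<open>R\<close> is a null set
    and makes \<open>e' * \<mu>\<close> strictly smaller than \<open>e\<close>.\<close>
  define e' where "e' = e / (\<mu> + 1)"
  have e': "e' > 0" "e' * \<mu> < e" using e \<mu> by (auto simp: e'_def field_simps add_pos_nonneg)
  obtain d where d: "d > 0" "\<And>x y. x \<in> R \<Longrightarrow> dist y a < d \<Longrightarrow> dist (f (x, y)) (f (x, a)) < e'"
    using continuous_slices_uniformly_close[OF R(1) f e'(1)] by metis
  have int: "(\<lambda>x. f (x, y)) integrable_on R" for y
    by (rule integrable_on_bounded_continuous[OF R continuous_on_slice[OF f]])
  have "dist (integral R (\<lambda>x. f (x, y))) (integral R (\<lambda>x. f (x, a))) < e" if "dist y a < d" for y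
  proof -
    have "dist (integral R (\<lambda>x. f (x, y))) (integral R (\<lambda>x. f (x, a)))
          = norm (integral R (\<lambda>x. f (x, y) - f (x, a)))"
      using int by (simp add: integral_diff dist_norm)
    also have "\<dots> \<le> e' * \<mu>" unfolding \<mu>_def
      using d(2)[OF _ that] by (intro norm_integral_le_const R integrable_diff int) (auto simp: dist_norm less_imp_le)
    finally show ?thesis using e' by simp
  qed
  then show "\<exists>d>0. \<forall>x'\<in>UNIV. dist x' a < d \<longrightarrow> dist (integral R (\<lambda>x. f (x, x'))) (integral R (\<lambda>x. f (x, a))) < e"
    using d(1) by blast
qed

lemma has_derivative_slice:
  assumes "(f has_derivative f') (at (x, y))"
  shows "((\<lambda>y. f (x, y)) has_derivative (\<lambda>h. f' (0, h))) (at y within S)"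
proof (rule has_derivative_at_withinI)
  have "((\<lambda>y. (x, y)) has_derivative (\<lambda>h. (0, h))) (at y)"
    by (intro has_derivative_Pair has_derivative_const has_derivative_ident)
  from has_derivative_compose[OF this assms]
  show "((\<lambda>y. f (x, y)) has_derivative (\<lambda>h. f' (0, h))) (at y)" .
qed

text \<open>Differentiation under the integral sign, obtained by bounding the linearization error of
  the integrand uniformly over \<open>x\<close> in \<open>R\<close> and integrating that bound over
  a set of finite measure.\<close>

lemma has_derivative_parametric_integral:
  fixes f :: "'a::euclidean_space \<times> 'b::euclidean_space \<Rightarrow> 'c::euclidean_space"
  assumes R: "bounded R" "R \<in> sets lebesgue"
    and f: "\<And>p. (f has_derivative f' p) (at p)" "\<And>h. continuous_on UNIV (\<lambda>p. f' p h)"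
  shows "((\<lambda>y. integral R (\<lambda>x. f (x, y))) has_derivative (\<lambda>h. integral R (\<lambda>x. f' (x, a) (0, h)))) (at a)"
proof -
  have cf: "continuous_on UNIV f"
    using has_derivative_continuous[OF f(1)] by (simp add: continuous_at_imp_continuous_on)
  have int: "(\<lambda>x. f (x, y)) integrable_on R" for y
    by (rule integrable_on_bounded_continuous[OF R continuous_on_slice[OF cf]])
  have int': "(\<lambda>x. f' (x, y) h) integrable_on R" for y h
    by (rule integrable_on_bounded_continuous[OF R continuous_on_slice[OF f(2)]])
  have lin: "linear (f' p)" for p
    using f(1) by (rule has_derivative_linear)
  have lin0: "linear (\<lambda>h. f' p (0, h))" for p
  proof (rule linearI)
    show "f' p (0, h + k) = f' p (0, h) + f' p (0, k)" for h k
      using linear_add[OF lin, of p "(0, h)" "(0, k)"] by simp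
    show "f' p (0, r *\<^sub>R h) = r *\<^sub>R f' p (0, h)" for r h
      using linear_scale[OF lin, of p r "(0, h)"] by simp
  qed
  have "linear (\<lambda>h. integral R (\<lambda>x. f' (x, a) (0, h)))"
    by (rule linearI) (simp_all add: linear_add[OF lin0] linear_scale[OF lin0] integral_add int')
  then have bl: "bounded_linear (\<lambda>h. integral R (\<lambda>x. f' (x, a) (0, h)))"
    by (simp add: linear_conv_bounded_linear)
  define \<mu> where "\<mu> = measure lebesgue R"
  have \<mu>: "\<mu> \<ge> 0" by (simp add: \<mu>_def)
  show ?thesis
    unfolding has_derivative_within_alt2
  proof (intro conjI bl allI impI)
    fix e :: real assume e: "e > 0"
    define e' where "e' = e / (\<mu> + 1)"
    have e': "e' > 0" "e' * \<mu> \<le> e" using e \<mu> by (auto simp: e'_def field_simps add_pos_nonneg)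
    \<comment> \<open>\<open>g\<close> dominates the change of the parameter derivative between
      parameter \<open>a\<close> and the current one. It vanishes at \<open>(x, a)\<close>, so
      closeness of slices is the same as smallness.\<close>
    define g where "g p = (\<Sum>b\<in>Basis. norm (f' p (0, b) - f' (fst p, a) (0, b)))" for p
    have "continuous_on UNIV (\<lambda>p. f' (fst p, a) h)" for h
      by (rule continuous_on_compose2[OF f(2)]) (auto intro!: continuous_intros)
    then have cg: "continuous_on UNIV g"
      unfolding g_def by (intro continuous_intros f(2))
    obtain d where d: "d > 0" "\<And>x y. x \<in> R \<Longrightarrow> dist y a < d \<Longrightarrow> dist (g (x, y)) (g (x, a)) < e'"
      using continuous_slices_uniformly_close[OF R(1) cg e'(1)] by metis
    have ge: "norm (f' (x, y) (0, h) - f' (x, a) (0, h)) \<le> e' * norm h"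
      if "x \<in> R" "dist y a < d" for x y h
    proof -
      have le: "g (x, y) \<le> e'" using d(2)[OF that] by (auto simp: g_def dist_real_def)
      have "norm (f' (x, y) (0, h) - f' (x, a) (0, h)) \<le> g (x, y) * norm h"
        unfolding g_def using norm_linear_le_sum_Basis[OF linear_compose_sub[OF lin0 lin0]] by simp
      also have "\<dots> \<le> e' * norm h"
        using le by (intro mult_right_mono) auto
      finally show ?thesis .
    qed
    have main: "norm (integral R (\<lambda>x. f (x, y)) - integral R (\<lambda>x. f (x, a)) - integral R (\<lambda>x. f' (x, a) (0, y - a)))
           \<le> e * norm (y - a)" if y: "dist y a < d" for y
    proof -
      have "norm (integral R (\<lambda>x. f (x, y)) - integral R (\<lambda>x. f (x, a)) - integral R (\<lambda>x. f' (x, a) (0, y - a)))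
         = norm (integral R (\<lambda>x. f (x, y) - f (x, a) - f' (x, a) (0, y - a)))"
        by (simp add: integral_diff int int' integrable_diff)
      also have "\<dots> \<le> (norm (y - a) * e') * \<mu>"
        unfolding \<mu>_def
      proof (intro norm_integral_le_const R integrable_diff int int')
        fix x assume x: "x \<in> R"
        show "norm (f (x, y) - f (x, a) - f' (x, a) (0, y - a)) \<le> norm (y - a) * e'"
        \<comment> \<open>For fixed \<open>x\<close>, the mean value inequality along the segment
          from \<open>a\<close> to \<open>y\<close> turns the derivative estimate \<open>ge\<close>
          into a bound on the linearization error.\<close>
        proof (rule differentiable_bound_linearization[where S = "ball a d" and f' = "\<lambda>y h. f' (x, y) (0, h)"])
          show "a + t *\<^sub>R (y - a) \<in> ball a d" if "t \<in> {0..1}" for t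
            using that y mult_left_le_one_le[of "norm (y - a)" t] by (simp add: dist_norm)
          show "onorm ((\<lambda>h. f' (x, z) (0, h)) - (\<lambda>h. f' (x, a) (0, h))) \<le> e'" if "z \<in> ball a d" for z
            using that ge[OF x] by (intro onorm_le) (auto simp: dist_commute)
        qed (use d(1) in \<open>auto intro: has_derivative_slice[OF f(1)]\<close>)
      qed
      also have "\<dots> = (e' * \<mu>) * norm (y - a)" by simp
      also have "\<dots> \<le> e * norm (y - a)" using e' by (intro mult_right_mono) auto
      finally show ?thesis .
    qed
    show "\<forall>\<^sub>F y in at a. norm (integral R (\<lambda>x. f (x, y)) - integral R (\<lambda>x. f (x, a)) -
             integral R (\<lambda>x. f' (x, a) (0, y - a))) \<le> e * norm (y - a)"
      unfolding eventually_at using d(1) main by blast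
  qed
qed

text \<open>The derivative of the integral in direction \<open>h\<close> is again a parametric
  integral, now of \<open>f'\<close> in direction \<open>(0, h)\<close>, so the induction runs over
  all integrands at once.\<close>

lemma Ck_parametric_integral:
  fixes f :: "'a::euclidean_space \<times> 'b::euclidean_space \<Rightarrow> 'c::euclidean_space"
  assumes R: "bounded R" "R \<in> sets lebesgue" and "Ck k f"
  shows "Ck k (\<lambda>y. integral R (\<lambda>x. f (x, y)))"
  using assms(3)
proof (induction k arbitrary: f)
  case 0
  then show ?case using continuous_on_parametric_integral[OF R] by simp
next
  case (Suc k)
  obtain f' where f: "\<And>x. (f has_derivative f' x) (at x)" "\<And>h. Ck k (\<lambda>x. f' x h)"
    using Suc.prems by (rule Ck_SucE) (rule that)
  show ?case
    by (rule Ck_SucI[OF has_derivative_parametric_integral[OF R f(1)]])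
       (auto intro: Suc.IH f(2) Ck_imp_continuous_on)
qed

section \<open>Global solutions of Lipschitz differential equations\<close>

text \<open>The factor \<open>1 / L\<close> is what counts: with \<open>L = 2 * M\<close> it cancels
  the Lipschitz constant in the Picard step and leaves one half.\<close>

lemma integral_exp_le:
  fixes t L :: real
  assumes "0 \<le> t" "L > 0"
  shows "integral {0..t} (\<lambda>s. exp (L * s)) \<le> exp (L * t) / L"
proof -
  have "((\<lambda>s. exp (L * s)) has_integral (exp (L * t) / L - exp (L * 0) / L)) {0..t}"
    using assms
    by (intro fundamental_theorem_of_calculus)
       (auto intro!: derivative_eq_intros simp flip: has_real_derivative_iff_has_vector_derivative)
  then show ?thesis using assms by (simp add: integral_unique)
qed

text \<open>Picard iteration; with \<open>M\<close> a Lipschitz constant, the weight \<open>exp (2 * M * t)\<close> makes the increments decay like \<open>(1/2)^n\<close>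
  on all of \<open>[0, \<infinity>)\<close>.\<close>
theorem ode_global_solution_exists:
  fixes F :: "'a::euclidean_space \<Rightarrow> 'a"
  assumes lip: "L-lipschitz_on UNIV F"
  obtains y where "y 0 = y0" "\<And>t. t \<ge> 0 \<Longrightarrow> (y has_vector_derivative F (y t)) (at t within {0..})"
proof -
  \<comment> \<open>A constant of at least 1 may be divided by, and it gives
    \<open>t \<le> exp (2 * M * t)\<close> for the first increment.\<close>
  define M where "M = max L 1"
  have M: "M \<ge> 1" by (simp add: M_def)
  have lipM: "norm (F x - F y) \<le> M * norm (x - y)" for x y
  proof -
    have "norm (F x - F y) \<le> L * norm (x - y)"
      using lipschitz_onD[OF lip, of x y] by (simp add: dist_norm)
    also have "\<dots> \<le> M * norm (x - y)" by (intro mult_right_mono) (auto simp: M_def)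
    finally show ?thesis .
  qed
  have contF: "continuous_on S F" for S
    using lipschitz_on_continuous_on[OF lip] continuous_on_subset by blast
  define P where "P = rec_nat (\<lambda>t::real. y0) (\<lambda>n p t. y0 + integral {0..t} (\<lambda>s. F (p s)))"
  have P0: "P 0 t = y0" and PS: "P (Suc n) t = y0 + integral {0..t} (\<lambda>s. F (P n s))" for n t
    by (simp_all add: P_def)
  have contP: "continuous_on {0..T} (P n)" for n T
  proof (induction n)
    case 0
    then show ?case by (simp add: P_def)
  next
    case (Suc n)
    have "continuous_on {0..T} (\<lambda>s. F (P n s))"
      by (rule continuous_on_compose2[OF contF Suc.IH subset_UNIV])
    then have "continuous_on {0..T} (\<lambda>t. y0 + integral {0..t} (\<lambda>s. F (P n s)))"
      by (intro continuous_on_add continuous_on_const indefinite_integral_continuous_1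
          integrable_continuous_real)
    then show ?case by (simp add: PS cong: continuous_on_cong)
  qed
  have contFP: "continuous_on {0..T} (\<lambda>s. F (P n s))" for n T
    by (rule continuous_on_compose2[OF contF contP subset_UNIV])
  have intFP: "(\<lambda>s. F (P n s)) integrable_on {0..T}" for n T
    by (rule integrable_continuous_real[OF contFP])
  define D where "D = norm (F y0)"
  have D: "D \<ge> 0" by (simp add: D_def)
  have step: "norm (P (Suc n) t - P n t) \<le> D * (1/2)^n * exp (2 * M * t)" if "t \<ge> 0" for n t
    using that
  proof (induction n arbitrary: t)
    case 0
    have "t \<le> 2 * M * t" using 0 M mult_right_mono[of 1 "2 * M" t] by simp
    also have "\<dots> \<le> exp (2 * M * t)" using exp_ge_add_one_self[of "2 * M * t"] by linarith
    finally have "D * t \<le> D * exp (2 * M * t)" using D by (rule mult_left_mono)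
    then show ?case using 0 by (simp add: PS P0 D_def mult.commute)
  next
    case (Suc n)
    have "P (Suc (Suc n)) t - P (Suc n) t = integral {0..t} (\<lambda>s. F (P (Suc n) s) - F (P n s))"
      unfolding PS[of "Suc n"] by (subst integral_diff[OF intFP intFP]) (simp add: PS)
    also have "norm \<dots> \<le> integral {0..t} (\<lambda>s. M * (D * (1/2)^n) * exp (2 * M * s))"
    proof (rule integral_norm_bound_integral)
      show "(\<lambda>s. F (P (Suc n) s) - F (P n s)) integrable_on {0..t}"
        by (intro integrable_diff intFP)
      show "(\<lambda>s. M * (D * (1/2)^n) * exp (2 * M * s)) integrable_on {0..t}"
        by (intro integrable_continuous_real continuous_intros)
      fix s assume s: "s \<in> {0..t}"
      have "norm (F (P (Suc n) s) - F (P n s)) \<le> M * norm (P (Suc n) s - P n s)" by (rule lipM)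
      also have "\<dots> \<le> M * (D * (1/2)^n * exp (2 * M * s))"
        using s M by (intro mult_left_mono Suc.IH) auto
      finally show "norm (F (P (Suc n) s) - F (P n s)) \<le> M * (D * (1/2)^n) * exp (2 * M * s)"
        by (simp add: mult.assoc)
    qed
    also have "\<dots> = M * (D * (1/2)^n) * integral {0..t} (\<lambda>s. exp (2 * M * s))"
      by (rule integral_mult_right)
    also have "\<dots> \<le> M * (D * (1/2)^n) * (exp (2 * M * t) / (2 * M))"
      using Suc.prems M D by (intro mult_left_mono integral_exp_le) auto
    also have "\<dots> = D * (1/2)^Suc n * exp (2 * M * t)" using M by simp
    finally show ?case .
  qed
  \<comment> \<open>Writing the limit as a telescoping series makes the Weierstrass test available,
    hence uniform convergence on every \<open>[0, T]\<close>.\<close>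
  define y where "y t = y0 + (\<Sum>n. P (Suc n) t - P n t)" for t
  have unif: "uniform_limit {0..T} P y sequentially" if T: "T \<ge> 0" for T
  proof -
    have "uniform_limit {0..T} (\<lambda>N t. \<Sum>n<N. P (Suc n) t - P n t) (\<lambda>t. \<Sum>n. P (Suc n) t - P n t) sequentially"
    proof (rule Weierstrass_m_test)
      show "summable (\<lambda>n. D * exp (2 * M * T) * (1/2)^n)"
        by (intro summable_mult summable_geometric) simp
      fix n t assume t: "t \<in> {0..T}"
      have "D * (1/2)^n * exp (2 * M * t) \<le> D * (1/2)^n * exp (2 * M * T)"
        using D M t by (intro mult_left_mono) auto
      then show "norm (P (Suc n) t - P n t) \<le> D * exp (2 * M * T) * (1/2)^n"
        using step[of t n] t by (simp add: mult_ac)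
    qed
    then have "uniform_limit {0..T} (\<lambda>N t. y0 + (\<Sum>n<N. P (Suc n) t - P n t)) y sequentially"
      unfolding y_def by (intro uniform_limit_add uniform_limit_const)
    moreover have "y0 + (\<Sum>n<N. P (Suc n) t - P n t) = P N t" for N t
      using sum_lessThan_telescope[of "\<lambda>n. P n t" N] by (simp add: P0)
    ultimately show ?thesis by simp
  qed
  have conty: "continuous_on {0..T} y" if "T \<ge> 0" for T
    by (rule uniform_limit_theorem[OF _ unif[OF that]]) (simp_all add: contP)
  have contFy: "continuous_on {0..T} (\<lambda>s. F (y s))" if "T \<ge> 0" for T
    by (rule continuous_on_compose2[OF contF conty[OF that] subset_UNIV])
  have y_eq: "y T = y0 + integral {0..T} (\<lambda>s. F (y s))" if T: "T \<ge> 0" for T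
  proof -
    \<comment> \<open>Lipschitz continuity preserves uniform convergence, which allows the limit to
      be taken inside the integral of the recursion.\<close>
    have "uniform_limit {0..T} (\<lambda>n s. F (P n s)) (\<lambda>s. F (y s)) sequentially"
      by (rule uniform_limit_compose_uniformly_continuous_on[OF unif[OF T] lipschitz_on_uniformly_continuous[OF lip]])
         auto
    then obtain I J where IJ: "\<And>n. ((\<lambda>s. F (P n s)) has_integral I n) {0..T}"
        "((\<lambda>s. F (y s)) has_integral J) {0..T}" "I \<longlonglongrightarrow> J"
      by (rule uniform_limit_integral[OF _ contFP sequentially_bot]) (rule that)
    then have "(\<lambda>n. y0 + integral {0..T} (\<lambda>s. F (P n s))) \<longlonglongrightarrow> y0 + integral {0..T} (\<lambda>s. F (y s))"
      using tendsto_add[OF tendsto_const IJ(3)] by (simp add: integral_unique[OF IJ(1)] integral_unique[OF IJ(2)])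
    then have "(\<lambda>n. P (Suc n) T) \<longlonglongrightarrow> y0 + integral {0..T} (\<lambda>s. F (y s))"
      by (simp add: PS)
    moreover have "(\<lambda>n. P n T) \<longlonglongrightarrow> y T"
      using tendsto_uniform_limitI[OF unif[OF T]] T by simp
    then have "(\<lambda>n. P (Suc n) T) \<longlonglongrightarrow> y T" by (rule LIMSEQ_Suc)
    ultimately show ?thesis by (rule LIMSEQ_unique[rotated])
  qed
  show ?thesis
  proof (rule that)
    show "y 0 = y0" by (simp add: y_eq)
    fix t :: real assume t: "t \<ge> 0"
    \<comment> \<open>Extending the interval to \<open>t + 1\<close> keeps \<open>t\<close> away
      from the right end, so the derivative within it agrees with the one within
      \<open>{0..}\<close>.\<close>
    have "((\<lambda>u. integral {0..u} (\<lambda>s. F (y s))) has_vector_derivative F (y t)) (at t within {0..t + 1})"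
      using t by (intro integral_has_vector_derivative contFy) auto
    then have "((\<lambda>u. y0 + integral {0..u} (\<lambda>s. F (y s))) has_vector_derivative F (y t)) (at t within {0..t + 1})"
      using has_vector_derivative_add[OF has_vector_derivative_const, of _ "F (y t)"] by fastforce
    then have "(y has_vector_derivative F (y t)) (at t within {0..t + 1})"
      by (rule has_vector_derivative_transform[rotated 2]) (use t in \<open>auto simp: y_eq\<close>)
    moreover have "at t within {0..t + 1} = at t within {0..}"
      by (rule at_within_nhd[of t "{..<t + 1}"]) auto
    ultimately show "(y has_vector_derivative F (y t)) (at t within {0..})" by simp
  qed
qed

section \<open>Gradient flows of squared norms\<close>

lemma norm_adjoint_le:
  fixes f :: "'a::euclidean_space \<Rightarrow> 'b::euclidean_space"
  assumes "linear f" and f: "\<And>h. norm (f h) \<le> K * norm h"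
  shows "norm (adjoint f u) \<le> K * norm u"
proof (cases "adjoint f u = 0")
  case True
  \<comment> \<open>The sign of \<open>K\<close> follows from the bound itself, evaluated at a basis
    vector, which has norm one.\<close>
  have "0 \<le> K * norm (SOME b. b \<in> (Basis :: 'a set))"
    using f norm_ge_zero order_trans by blast
  then have "0 \<le> K" using some_in_eq[of "Basis :: 'a set"] by simp
  then show ?thesis using True by simp
next
  case False
  \<comment> \<open>Testing \<open>adjoint f u\<close> against itself moves one copy back to
    \<open>f\<close>, where the bound \<open>K\<close> applies; the common factor is then
    cancelled.\<close>
  have "norm (adjoint f u) * norm (adjoint f u) = f (adjoint f u) \<bullet> u"
    using adjoint_works[OF assms(1), of "adjoint f u" u]
    by (simp add: power2_norm_eq_inner flip: power2_eq_square)
  also have "\<dots> \<le> norm (f (adjoint f u)) * norm u" by (rule norm_cauchy_schwarz)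
  also have "\<dots> \<le> (K * norm (adjoint f u)) * norm u"
    by (intro mult_right_mono f) simp
  finally have "norm (adjoint f u) * norm (adjoint f u) \<le> norm (adjoint f u) * (K * norm u)"
    by (simp add: mult_ac)
  then show ?thesis using False by simp
qed

text \<open>Only the values of \<open>f\<close> on basis vectors occur on the right, so regularity
  of directional derivatives passes to the adjoint, and linearity in \<open>f\<close> becomes
  visible.\<close>

lemma adjoint_eq_sum_Basis:
  fixes f :: "'a::euclidean_space \<Rightarrow> 'b::euclidean_space"
  assumes "linear f"
  shows "adjoint f u = (\<Sum>b\<in>Basis. (f b \<bullet> u) *\<^sub>R b)"
  using euclidean_representation[of "adjoint f u"]
  by (simp add: inner_commute[of "adjoint f u"] adjoint_works[OF assms])

lemma has_derivative_norm_squared: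
  fixes G :: "'a::euclidean_space \<Rightarrow> 'b::euclidean_space"
  assumes "(G has_derivative G') (at x)"
  shows "((\<lambda>x. (norm (G x))\<^sup>2) has_derivative (\<lambda>h. (2 *\<^sub>R adjoint G' (G x)) \<bullet> h)) (at x)"
proof -
  have "((\<lambda>x. G x \<bullet> G x) has_derivative (\<lambda>h. G x \<bullet> G' h + G' h \<bullet> G x)) (at x)"
    by (rule has_derivative_inner[OF assms assms])
  moreover have "G x \<bullet> G' h + G' h \<bullet> G x = (2 *\<^sub>R adjoint G' (G x)) \<bullet> h" for h
    using adjoint_works[OF has_derivative_linear[OF assms], of h "G x"] by (simp add: inner_commute)
  ultimately show ?thesis by (simp add: power2_norm_eq_inner)
qed

lemma at_within_Ici_eq_at: "a < t \<Longrightarrow> at t within {a..} = at (t :: real)"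
  by (rule at_within_open_subset[of t "{a<..}"]) auto

text \<open>The gradient of the squared norm is twice \<open>adjoint (G' y) (G y)\<close>, so
  \<open>lower\<close> amounts to a Polyak-Lojasiewicz inequality, while \<open>upper\<close>
  controls the speed. Both hold only on the ball; \<open>small\<close> says that the resulting bound
  on the displacement is less than its radius.\<close>

locale coercive_gradient_flow =
  fixes G :: "'a::euclidean_space \<Rightarrow> 'a" and G' :: "'a \<Rightarrow> 'a \<Rightarrow> 'a"
    and y0 :: 'a and r m N K :: real
  assumes deriv: "\<And>y. (G has_derivative G' y) (at y)"
    and r: "r > 0" and m: "m > 0" and N: "N \<ge> 0" and K: "K \<ge> 0"
    and lower: "\<And>y u. y \<in> cball y0 r \<Longrightarrow> m * norm u \<le> norm (adjoint (G' y) u)"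
    and upper: "\<And>y u. y \<in> cball y0 r \<Longrightarrow> norm (adjoint (G' y) u) \<le> N * norm u"
    and start: "norm (G y0) \<le> K"
    and small: "N * K / m\<^sup>2 < r"
begin

lemma continuous_G: "continuous_on S G"
  using has_derivative_continuous[OF deriv] by (simp add: continuous_at_imp_continuous_on)

text \<open>The differential equation is required only at positive times at which \<gamma> lies in
  the ball. The results therefore cover both genuine gradient flows and trajectories of a field
  altered outside the ball.\<close>

context
  fixes \<gamma> :: "real \<Rightarrow> 'a"
  assumes init: "\<gamma> 0 = y0" and cont: "continuous_on {0..} \<gamma>"
    and flow: "\<And>t. t > 0 \<Longrightarrow> \<gamma> t \<in> cball y0 r \<Longrightarrow>
      (\<gamma> has_vector_derivative - (2 *\<^sub>R adjoint (G' (\<gamma> t)) (G (\<gamma> t)))) (at t)"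
begin

text \<open>Along the flow the squared norm of \<open>G\<close> has derivative
  \<open>- 4 * (norm g)\<^sup>2\<close>, at most \<open>- 4 * m\<^sup>2\<close> times itself. The
  integrating factor in \<open>W\<close> turns this into monotonicity.\<close>

lemma norm_G_decay:
  assumes T: "0 \<le> T" and inside: "\<And>t. 0 \<le> t \<Longrightarrow> t < T \<Longrightarrow> \<gamma> t \<in> cball y0 r"
  shows "norm (G (\<gamma> T)) \<le> K * exp (- 2 * m\<^sup>2 * T)"
proof -
  define W where "W t = (norm (G (\<gamma> t)))\<^sup>2 * exp (4 * m\<^sup>2 * t)" for t
  have "W T \<le> W 0"
  \<comment> \<open>The version for open intervals fits because nothing is known yet about the
    position at time \<open>T\<close>, nor about the derivative at time 0.\<close>
  proof (rule DERIV_nonpos_imp_decreasing_open[of 0 T W])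
    show "0 \<le> T" by fact
    have "continuous_on {0..T} (\<lambda>t. G (\<gamma> t))"
      by (rule continuous_on_compose2[OF continuous_G[of UNIV] continuous_on_subset[OF cont]]) auto
    then show "continuous_on {0..T} W" unfolding W_def by (intro continuous_intros)
    fix t assume t: "0 < t" "t < T"
    define g where "g = adjoint (G' (\<gamma> t)) (G (\<gamma> t))"
    have in_t: "\<gamma> t \<in> cball y0 r" using inside t by simp
    have "(\<gamma> has_derivative (\<lambda>s. s *\<^sub>R (- (2 *\<^sub>R g)))) (at t)"
      using flow[OF t(1) in_t] by (simp add: has_vector_derivative_def g_def)
    from has_derivative_compose[OF this has_derivative_norm_squared[OF deriv]]
    have "((\<lambda>t. (norm (G (\<gamma> t)))\<^sup>2) has_real_derivative - 4 * (norm g)\<^sup>2) (at t)"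
      unfolding has_field_derivative_def
      by (rule has_derivative_eq_rhs) (auto simp: fun_eq_iff g_def power2_norm_eq_inner)
    moreover have "((\<lambda>t. exp (4 * m\<^sup>2 * t)) has_real_derivative exp (4 * m\<^sup>2 * t) * (4 * m\<^sup>2)) (at t)"
      by (auto intro!: derivative_eq_intros)
    ultimately have "(W has_real_derivative
        (- 4 * (norm g)\<^sup>2 * exp (4 * m\<^sup>2 * t) + exp (4 * m\<^sup>2 * t) * (4 * m\<^sup>2) * (norm (G (\<gamma> t)))\<^sup>2)) (at t)"
      unfolding W_def by (rule DERIV_mult)
    moreover have "(m * norm (G (\<gamma> t)))\<^sup>2 \<le> (norm g)\<^sup>2"
      unfolding g_def using lower[OF in_t] m by (intro power_mono) auto
    then have "- 4 * (norm g)\<^sup>2 * exp (4 * m\<^sup>2 * t) + exp (4 * m\<^sup>2 * t) * (4 * m\<^sup>2) * (norm (G (\<gamma> t)))\<^sup>2 \<le> 0"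
      using mult_right_mono[of "(m * norm (G (\<gamma> t)))\<^sup>2" "(norm g)\<^sup>2" "4 * exp (4 * m\<^sup>2 * t)"]
      by (simp add: power_mult_distrib algebra_simps)
    ultimately show "\<exists>y. (W has_real_derivative y) (at t) \<and> y \<le> 0" by blast
  qed
  also have "W 0 \<le> K\<^sup>2" using start by (simp add: W_def init power_mono)
  finally have "(norm (G (\<gamma> T)))\<^sup>2 * exp (4 * m\<^sup>2 * T) \<le> K\<^sup>2" by (simp add: W_def)
  moreover have "exp (4 * m\<^sup>2 * T) = (exp (2 * m\<^sup>2 * T))\<^sup>2" by (simp add: exp_double[symmetric])
  ultimately have "(norm (G (\<gamma> T)) * exp (2 * m\<^sup>2 * T))\<^sup>2 \<le> K\<^sup>2"
    by (simp add: power_mult_distrib)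
  then have "norm (G (\<gamma> T)) * exp (2 * m\<^sup>2 * T) \<le> K" using K by (rule power2_le_imp_le)
  then show ?thesis by (simp add: exp_minus field_simps)
qed

text \<open>The speed is at most \<open>2 * N * K * exp (- 2 * m\<^sup>2 * t)\<close> by
  \<open>upper\<close> and the decay of \<open>G\<close>; integrating from \<open>s\<close> onwards
  gives the bound. The endpoint \<open>T\<close> itself may be a first exit time.\<close>

lemma displacement_bound:
  assumes s: "0 \<le> s" "s \<le> T" and inside: "\<And>t. 0 \<le> t \<Longrightarrow> t < T \<Longrightarrow> \<gamma> t \<in> cball y0 r"
  shows "norm (\<gamma> T - \<gamma> s) \<le> N * K / m\<^sup>2 * exp (- 2 * m\<^sup>2 * s)"
proof (cases "s = T")
  case True
  then show ?thesis using N K by simp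
next
  case False
  define \<phi> where "\<phi> t = - (N * K / m\<^sup>2) * exp (- 2 * m\<^sup>2 * t)" for t
  have "norm (\<gamma> T - \<gamma> s) \<le> \<phi> T - \<phi> s"
  proof (rule differentiable_bound_general)
    show "s < T" using False s by simp
    show "continuous_on {s..T} \<gamma>" using cont s by (auto intro: continuous_on_subset)
    show "continuous_on {s..T} \<phi>" unfolding \<phi>_def by (intro continuous_intros)
    fix t assume t: "s < t" "t < T"
    have in_t: "\<gamma> t \<in> cball y0 r" using inside s t by simp
    show "(\<gamma> has_vector_derivative - (2 *\<^sub>R adjoint (G' (\<gamma> t)) (G (\<gamma> t)))) (at t)"
      using t s by (intro flow in_t) simp
    show "(\<phi> has_vector_derivative 2 * N * K * exp (- 2 * m\<^sup>2 * t)) (at t)"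
      unfolding \<phi>_def has_real_derivative_iff_has_vector_derivative[symmetric]
      using m by (auto intro!: derivative_eq_intros simp: power2_eq_square power4_eq_xxxx)
    have "norm (adjoint (G' (\<gamma> t)) (G (\<gamma> t))) \<le> N * norm (G (\<gamma> t))" by (rule upper[OF in_t])
    also have "\<dots> \<le> N * (K * exp (- 2 * m\<^sup>2 * t))"
      using N s t inside by (intro mult_left_mono norm_G_decay) auto
    finally show "norm (- (2 *\<^sub>R adjoint (G' (\<gamma> t)) (G (\<gamma> t)))) \<le> 2 * N * K * exp (- 2 * m\<^sup>2 * t)"
      by simp
  qed
  also have "\<dots> \<le> - \<phi> s" using N K by (simp add: \<phi>_def)
  finally show ?thesis by (simp add: \<phi>_def)
qed

text \<open>First exit argument: up to the first time at distance at least \<open>r\<close> the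
  displacement bound applies, and by \<open>small\<close> it keeps the distance strictly below
  \<open>r\<close> at that very time.\<close>

lemma stays_inside:
  assumes "0 \<le> t"
  shows "\<gamma> t \<in> cball y0 r"
proof (rule ccontr)
  assume out: "\<gamma> t \<notin> cball y0 r"
  have cd: "continuous_on {0..} (\<lambda>s. dist y0 (\<gamma> s))"
    using cont by (intro continuous_intros)
  \<comment> \<open>The weak inequality makes \<open>S\<close> closed, so that a least time
    exists.\<close>
  define S where "S = {s \<in> {0..t}. r \<le> dist y0 (\<gamma> s)}"
  have "closed S" unfolding S_def
    by (intro continuous_on_closed_Collect_le continuous_on_const continuous_on_subset[OF cd]) auto
  moreover have "bounded S" by (rule bounded_subset[of "{0..t}"]) (auto simp: S_def)
  moreover have "t \<in> S" using assms out by (auto simp: S_def)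
  ultimately obtain s where s: "s \<in> S" "\<And>u. u \<in> S \<Longrightarrow> s \<le> u"
    using compact_attains_inf[of S] compact_eq_bounded_closed by blast
  have "\<gamma> u \<in> cball y0 r" if "0 \<le> u" "u < s" for u
    using s(2)[of u] s(1) that by (cases "r \<le> dist y0 (\<gamma> u)") (auto simp: S_def)
  then have "norm (\<gamma> s - \<gamma> 0) \<le> N * K / m\<^sup>2 * exp (- 2 * m\<^sup>2 * 0)"
    using s(1) by (intro displacement_bound) (auto simp: S_def)
  then have "dist y0 (\<gamma> s) < r" using small by (simp add: init dist_norm norm_minus_commute)
  then show False using s(1) by (simp add: S_def)
qed

text \<open>The displacement after time \<open>s\<close> decays exponentially in \<open>s\<close>,
  which makes the trajectory Cauchy. Its limit is a zero since \<open>G\<close> is continuous and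
  tends to 0 along the flow.\<close>

lemma converges_to_zero:
  obtains ys where "G ys = 0" "ys \<in> cball y0 r" "(\<gamma> \<longlongrightarrow> ys) at_top"
proof -
  define c where "c = 2 * m\<^sup>2"
  have c: "c > 0" using m by (simp add: c_def)
  define Q where "Q = N * K / m\<^sup>2"
  have exp0: "((\<lambda>t. Q * exp (- c * t)) \<longlongrightarrow> 0) at_top" for Q
  proof -
    have "filterlim (\<lambda>t. - c * t) at_bot at_top"
      using c filterlim_tendsto_neg_mult_at_bot[OF tendsto_const, of "-c" "\<lambda>t. t" at_top]
      by (simp add: filterlim_ident)
    then have "((\<lambda>t. exp (- c * t)) \<longlongrightarrow> 0) at_top"
      by (rule filterlim_compose[OF exp_at_bot])
    then show ?thesis by (rule tendsto_mult_right_zero)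
  qed
  have dist_le: "norm (\<gamma> T - \<gamma> s) \<le> Q * exp (- c * s)" if "0 \<le> s" "s \<le> T" for s T
    using displacement_bound[of s T] that stays_inside by (simp add: Q_def c_def)
  have "Cauchy (\<lambda>n. \<gamma> (real n))"
    unfolding Cauchy_altdef2
  proof (intro allI impI)
    fix e :: real assume "e > 0"
    then have "\<forall>\<^sub>F t in at_top. Q * exp (- c * t) < e"
      by (rule order_tendstoD(2)[OF exp0])
    then have "\<forall>\<^sub>F n in sequentially. Q * exp (- c * real n) < e"
      using filterlim_real_sequentially by (rule eventually_compose_filterlim)
    then obtain n where "Q * exp (- c * real n) < e"
      by (auto simp: eventually_sequentially)
    then show "\<exists>n. \<forall>k\<ge>n. dist (\<gamma> (real k)) (\<gamma> (real n)) < e"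
      unfolding dist_norm by (intro exI[of _ n] allI impI) (rule le_less_trans[OF dist_le], auto)
  qed
  then obtain ys where ys: "(\<lambda>n. \<gamma> (real n)) \<longlonglongrightarrow> ys"
    using Cauchy_convergent convergent_def by blast
  \<comment> \<open>Letting the later time run through the integers gives a rate valid from every
    real time \<open>s\<close>; this upgrades convergence at integer times to convergence at
    \<open>at_top\<close>.\<close>
  have bound: "norm (ys - \<gamma> s) \<le> Q * exp (- c * s)" if "0 \<le> s" for s
  proof (rule tendsto_upperbound)
    show "((\<lambda>n. norm (\<gamma> (real n) - \<gamma> s)) \<longlonglongrightarrow> norm (ys - \<gamma> s))"
      using ys by (intro tendsto_intros)
    show "\<forall>\<^sub>F n in sequentially. norm (\<gamma> (real n) - \<gamma> s) \<le> Q * exp (- c * s)"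
      using eventually_ge_at_top[of "nat \<lceil>s\<rceil>"]
      by eventually_elim (intro dist_le that, linarith)
  qed simp
  have "((\<lambda>t. \<gamma> t - ys) \<longlongrightarrow> 0) at_top"
  proof (rule Lim_null_comparison)
    show "\<forall>\<^sub>F t in at_top. norm (\<gamma> t - ys) \<le> Q * exp (- c * t)"
      using eventually_ge_at_top[of 0] by eventually_elim (use bound in \<open>simp add: norm_minus_commute\<close>)
  qed (rule exp0)
  then have lim: "(\<gamma> \<longlongrightarrow> ys) at_top" by (simp add: LIM_zero_iff)
  have "((\<lambda>t. G (\<gamma> t)) \<longlongrightarrow> G ys) at_top"
    using has_derivative_continuous[OF deriv] lim by (rule isCont_tendsto_compose)
  moreover have "((\<lambda>t. G (\<gamma> t)) \<longlongrightarrow> 0) at_top"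
  proof (rule Lim_null_comparison)
    show "\<forall>\<^sub>F t in at_top. norm (G (\<gamma> t)) \<le> K * exp (- c * t)"
      using eventually_ge_at_top[of 0]
      by eventually_elim (use norm_G_decay stays_inside in \<open>simp add: c_def\<close>)
  qed (rule exp0)
  ultimately have "G ys = 0" using tendsto_unique trivial_limit_at_top_linorder by blast
  moreover have "ys \<in> cball y0 r"
    using stays_inside by (intro closed_sequentially[OF closed_cball _ ys]) auto
  ultimately show ?thesis using lim that by blast
qed

end

text \<open>The field is precomposed with the projection onto the ball to make it globally Lipschitz; the
  resulting trajectory never leaves the ball, so the projection is invisible along it.\<close>
lemma flow_exists:
  assumes "Ck 2 G"
  obtains \<gamma> where "\<gamma> 0 = y0"
    "\<And>t. t \<ge> 0 \<Longrightarrow> (\<gamma> has_vector_derivative - (2 *\<^sub>R adjoint (G' (\<gamma> t)) (G (\<gamma> t)))) (at t within {0..})"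
proof -
  define F where "F y = - (2 *\<^sub>R adjoint (G' y) (G y))" for y
  \<comment> \<open>In this form \<open>F\<close> is built from \<open>G\<close> and its directional
    derivatives, so two orders of regularity of \<open>G\<close> leave one for \<open>F\<close>,
    enough for a Lipschitz bound on the ball.\<close>
  have "F = (\<lambda>y. (-2) *\<^sub>R (\<Sum>b\<in>Basis. (G' y b \<bullet> G y) *\<^sub>R b))"
    by (simp add: fun_eq_iff F_def adjoint_eq_sum_Basis[OF has_derivative_linear[OF deriv]])
  moreover have "Ck (Suc 0) (\<lambda>y. G' y b)" for b
    using assms deriv by (intro Ck_SucD[of "Suc 0" G G']) (simp_all only: numeral_2_eq_2)
  moreover have "Ck (Suc 0) G" using assms by (rule Ck_mono) simp
  ultimately have "Ck (Suc 0) F"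
    by (simp only:) (intro Ck_scaleR Ck_sum Ck_inner Ck_const)
  then obtain L where L: "L-lipschitz_on (cball y0 r) F"
    by (rule Ck_lipschitz_on_compact_convex[OF _ compact_cball convex_cball]) (rule that)
  define p where "p = closest_point (cball y0 r)"
  have p: "p y \<in> cball y0 r" for y
    unfolding p_def using r by (intro closest_point_in_set) auto
  have "L-lipschitz_on UNIV (\<lambda>y. F (p y))"
  proof (rule lipschitz_onI)
    show L0: "0 \<le> L" using L by (rule lipschitz_on_nonneg)
    fix x y
    have "dist (F (p x)) (F (p y)) \<le> L * dist (p x) (p y)"
      using lipschitz_onD[OF L p p] .
    also have "\<dots> \<le> L * dist x y"
      unfolding p_def using r L0 by (intro mult_left_mono closest_point_lipschitz) auto
    finally show "dist (F (p x)) (F (p y)) \<le> L * dist x y" .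
  qed
  then obtain \<gamma> where \<gamma>: "\<gamma> 0 = y0"
      "\<And>t. t \<ge> 0 \<Longrightarrow> (\<gamma> has_vector_derivative F (p (\<gamma> t))) (at t within {0..})"
    using ode_global_solution_exists by metis
  have F_p: "F (p y) = F y" if "y \<in> cball y0 r" for y
    using closest_point_self[OF that] by (simp add: p_def)
  have inside: "\<gamma> t \<in> cball y0 r" if "t \<ge> 0" for t
  proof (rule stays_inside[of \<gamma>, OF \<gamma>(1) _ _ that])
    show "continuous_on {0..} \<gamma>"
      unfolding continuous_on_eq_continuous_within
      using \<gamma>(2) has_vector_derivative_continuous by fastforce
    fix t :: real assume t: "t > 0" "\<gamma> t \<in> cball y0 r"
    show "(\<gamma> has_vector_derivative - (2 *\<^sub>R adjoint (G' (\<gamma> t)) (G (\<gamma> t)))) (at t)"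
      using \<gamma>(2)[of t] t F_p by (simp add: F_def at_within_Ici_eq_at)
  qed
  show ?thesis
    by (rule that[of \<gamma>, OF \<gamma>(1)]) (use \<gamma>(2) F_p inside in \<open>simp add: F_def\<close>)
qed

end

section \<open>Constants uniform in the penalty and the weights\<close>

lemma adjoint_lower_bound_perturb:
  fixes f g :: "'a::euclidean_space \<Rightarrow> 'b::euclidean_space"
  assumes "linear f" "linear g" and close: "\<And>h. norm (f h - g h) \<le> e * norm h"
    and lower: "\<sigma> * norm u \<le> norm (adjoint g u)"
  shows "(\<sigma> - e) * norm u \<le> norm (adjoint f u)"
proof -
  have lin: "linear (\<lambda>h. f h - g h)" using assms(1,2) by (rule linear_compose_sub)
  have "adjoint f u = adjoint g u + adjoint (\<lambda>h. f h - g h) u"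
    by (simp add: adjoint_eq_sum_Basis assms(1,2) lin inner_diff_left scaleR_diff_left sum_subtractf)
  then have "norm (adjoint g u) \<le> norm (adjoint f u) + norm (adjoint (\<lambda>h. f h - g h) u)"
    by (metis add_diff_cancel_right' norm_triangle_ineq4)
  also have "norm (adjoint (\<lambda>h. f h - g h) u) \<le> e * norm u"
    by (rule norm_adjoint_le[OF lin close])
  finally show ?thesis using lower by (simp add: left_diff_distrib)
qed

text \<open>The radius is fixed by \<open>A\<close> alone. The weights enter linearly with modulus
  at most 1, so summing the bounds for \<open>b\<close> and the \<open>c k\<close> covers every
  \<open>w\<close>; \<alpha> is made small only afterwards. Existence of a flow is part of the
  conclusion, so the claim about all flows is not vacuous.\<close>

theorem penalized_gradient_flow_converges:
  fixes A b :: "real^'n \<Rightarrow> real^'n" and c :: "'k \<Rightarrow> real^'n \<Rightarrow> real^'n"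
  assumes I: "finite I" and A: "Ck 2 A" and b: "Ck 2 b" and c: "\<And>k. k \<in> I \<Longrightarrow> Ck 2 (c k)"
    and A_y0: "A y0 = 0" and A0: "(A has_derivative A0) (at y0)"
    and lower: "\<And>u. \<sigma> * norm u \<le> norm (adjoint A0 u)" and \<sigma>: "\<sigma> > 0"
  obtains r \<alpha>1 where "r > 0" "\<alpha>1 > 0"
    "\<And>\<alpha> w G. \<lbrakk>0 < \<alpha>; \<alpha> \<le> 1; \<alpha> \<le> \<alpha>1; \<forall>k\<in>I. \<bar>w k\<bar> \<le> 1;
        \<And>y. G y = (1 / \<alpha>) *\<^sub>R A y + (b y + (\<Sum>k\<in>I. w k *\<^sub>R c k y))\<rbrakk> \<Longrightarrow>
      (\<exists>\<gamma>. neg_grad_flow (\<lambda>y. (norm (G y))\<^sup>2) y0 \<gamma>) \<and>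
      (\<forall>\<gamma>. neg_grad_flow (\<lambda>y. (norm (G y))\<^sup>2) y0 \<gamma> \<longrightarrow>
         (\<exists>ys. G ys = 0 \<and> ys \<in> cball y0 r \<and> (\<gamma> \<longlongrightarrow> ys) at_top))"
proof -
  have two: "Ck 2 f \<longleftrightarrow> Ck (Suc (Suc 0)) f" for f :: "real^'n \<Rightarrow> real^'n"
    by (simp only: numeral_2_eq_2)
  obtain A' where A': "\<And>y. (A has_derivative A' y) (at y)" "\<And>h. Ck (Suc 0) (\<lambda>y. A' y h)"
    using A unfolding two by (rule Ck_SucE) (rule that)
  obtain b' where b': "\<And>y. (b has_derivative b' y) (at y)" "\<And>h. Ck (Suc 0) (\<lambda>y. b' y h)"
    using b unfolding two by (rule Ck_SucE) (rule that)
  have "\<exists>c'. \<forall>k\<in>I. (\<forall>y. (c k has_derivative c' k y) (at y)) \<and> (\<forall>h. Ck (Suc 0) (\<lambda>y. c' k y h))"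
    using c unfolding two by (intro bchoice ballI) (metis Ck_SucE)
  then obtain c' where c': "\<And>k y. k \<in> I \<Longrightarrow> (c k has_derivative c' k y) (at y)"
      "\<And>k h. k \<in> I \<Longrightarrow> Ck (Suc 0) (\<lambda>y. c' k y h)" by blast
  have A'_y0: "A' y0 = A0" using A'(1) A0 by (rule has_derivative_unique)
  \<comment> \<open>One quarter of \<sigma> is spent on the variation of \<open>A'\<close> over the
    ball and another on \<open>B'\<close> through the choice of \<open>\<alpha>1\<close>; half of
    \<open>\<sigma> / \<alpha>\<close> survives as the lower bound.\<close>
  obtain r where r: "r > 0" "\<And>y h. y \<in> cball y0 r \<Longrightarrow> norm (A' y h - A0 h) \<le> \<sigma> / 4 * norm h"
    using derivative_close_on_cball[OF A'(1) Ck_imp_continuous_on[OF A'(2)], of "\<sigma> / 4" y0] \<sigma>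
    unfolding A'_y0 by auto
  obtain NA where NA: "NA > 0" "\<And>y h. y \<in> cball y0 r \<Longrightarrow> norm (A' y h) \<le> NA * norm h"
    using derivative_bounded_on_compact[OF A'(1) Ck_imp_continuous_on[OF A'(2)] compact_cball] by metis
  obtain Mb where Mb: "Mb > 0" "\<And>y h. y \<in> cball y0 r \<Longrightarrow> norm (b' y h) \<le> Mb * norm h"
    using derivative_bounded_on_compact[OF b'(1) Ck_imp_continuous_on[OF b'(2)] compact_cball] by metis
  have "\<forall>k\<in>I. \<exists>M. M > 0 \<and> (\<forall>y\<in>cball y0 r. \<forall>h. norm (c' k y h) \<le> M * norm h)"
  proof
    fix k assume k: "k \<in> I"
    show "\<exists>M. M > 0 \<and> (\<forall>y\<in>cball y0 r. \<forall>h. norm (c' k y h) \<le> M * norm h)"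
      using derivative_bounded_on_compact[OF c'(1)[OF k] Ck_imp_continuous_on[OF c'(2)[OF k]] compact_cball]
      by metis
  qed
  then obtain Mc where Mc: "\<And>k. k \<in> I \<Longrightarrow> Mc k > 0"
      "\<And>k y h. k \<in> I \<Longrightarrow> y \<in> cball y0 r \<Longrightarrow> norm (c' k y h) \<le> Mc k * norm h"
    by (metis bchoice)
  define M where "M = Mb + (\<Sum>k\<in>I. Mc k)"
  have M: "M > 0" unfolding M_def using Mb(1) Mc(1) by (intro add_pos_nonneg sum_nonneg) (auto intro: less_imp_le)
  \<comment> \<open>The summand 1 makes \<open>K\<close> positive, as it stands in a denominator of
    \<open>\<alpha>1\<close>.\<close>
  define K where "K = 1 + norm (b y0) + (\<Sum>k\<in>I. norm (c k y0))"
  have K: "K > 0" unfolding K_def by (intro add_pos_nonneg sum_nonneg) auto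
  \<comment> \<open>Since \<alpha> is at most 1, \<open>M \<le> M / \<alpha>\<close>, and
    \<open>N / \<alpha>\<close> bounds both parts of \<open>G'\<close> together.\<close>
  define N where "N = NA + M"
  have N: "N > 0" using NA(1) M by (simp add: N_def)
  \<comment> \<open>The first entry gives \<open>M \<le> \<sigma> / (4 * \<alpha>)\<close>. The
    second makes the displacement bound, which equals
    \<open>4 * N * K * \<alpha> / \<sigma>\<^sup>2\<close>, at most \<open>r / 2\<close>.\<close>
  define \<alpha>1 where "\<alpha>1 = min (\<sigma> / (4 * M)) (r * \<sigma>\<^sup>2 / (8 * N * K))"
  show ?thesis
  proof (rule that[OF r(1)])
    show "\<alpha>1 > 0" using r(1) \<sigma> M N K by (simp add: \<alpha>1_def)
    fix \<alpha> :: real and w :: "'k \<Rightarrow> real" and G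
    assume \<alpha>: "0 < \<alpha>" "\<alpha> \<le> 1" "\<alpha> \<le> \<alpha>1" and w: "\<forall>k\<in>I. \<bar>w k\<bar> \<le> 1"
      and G: "\<And>y. G y = (1 / \<alpha>) *\<^sub>R A y + (b y + (\<Sum>k\<in>I. w k *\<^sub>R c k y))"
    have G_eq: "G = (\<lambda>y. (1 / \<alpha>) *\<^sub>R A y + (b y + (\<Sum>k\<in>I. w k *\<^sub>R c k y)))"
      using G by blast
    define B' where "B' y h = b' y h + (\<Sum>k\<in>I. w k *\<^sub>R c' k y h)" for y h
    define G' where "G' y h = (1 / \<alpha>) *\<^sub>R A' y h + B' y h" for y h
    have CkG: "Ck 2 G" unfolding G_eq
      by (intro Ck_add Ck_sum Ck_scaleR Ck_const A b c)
    have derivG: "(G has_derivative G' y) (at y)" for y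
      unfolding G_eq G'_def[abs_def] B'_def
      by (intro has_derivative_add has_derivative_sum has_derivative_scaleR_right A' b' c')
    have B'_le: "norm (B' y h) \<le> M * norm h" if y: "y \<in> cball y0 r" for y h
    proof -
      have "norm (B' y h) \<le> norm (b' y h) + (\<Sum>k\<in>I. norm (w k *\<^sub>R c' k y h))"
        unfolding B'_def by (intro norm_triangle_le add_left_mono norm_sum)
      also have "\<dots> \<le> Mb * norm h + (\<Sum>k\<in>I. Mc k * norm h)"
      proof (intro add_mono sum_mono Mb(2) y)
        fix k assume k: "k \<in> I"
        have "norm (w k *\<^sub>R c' k y h) \<le> 1 * norm (c' k y h)"
          using w k by (simp add: mult_left_le_one_le)
        then show "norm (w k *\<^sub>R c' k y h) \<le> Mc k * norm h" using Mc(2)[OF k y, of h] by simp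
      qed
      finally show ?thesis by (simp add: M_def distrib_right sum_distrib_right)
    qed
    have startK: "norm (G y0) \<le> K"
    proof -
      have "norm (G y0) \<le> norm (b y0) + (\<Sum>k\<in>I. norm (w k *\<^sub>R c k y0))"
        unfolding G A_y0 scaleR_zero_right add_0_left
        by (intro norm_triangle_le add_left_mono norm_sum)
      also have "\<dots> \<le> norm (b y0) + (\<Sum>k\<in>I. norm (c k y0))"
        using w by (intro add_left_mono sum_mono) (simp add: mult_left_le_one_le)
      finally show ?thesis by (simp add: K_def)
    qed
    interpret coercive_gradient_flow G G' y0 r "\<sigma> / (2 * \<alpha>)" "N / \<alpha>" K
    proof
      fix y u assume y: "y \<in> cball y0 r"
      have lin: "linear (G' y)" using derivG by (rule has_derivative_linear)
      have linA0: "linear A0" using A0 by (rule has_derivative_linear)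
      have linA0': "linear (\<lambda>h. (1 / \<alpha>) *\<^sub>R A0 h)" using linA0 by (rule linear_compose_scale_right)
      have "norm (G' y h - (1 / \<alpha>) *\<^sub>R A0 h) \<le> \<sigma> / (2 * \<alpha>) * norm h" for h
      proof -
        have "norm (G' y h - (1 / \<alpha>) *\<^sub>R A0 h) = norm ((1 / \<alpha>) *\<^sub>R (A' y h - A0 h) + B' y h)"
          by (simp add: G'_def algebra_simps)
        also have "\<dots> \<le> (1 / \<alpha>) * norm (A' y h - A0 h) + norm (B' y h)"
          using norm_triangle_ineq[of "(1 / \<alpha>) *\<^sub>R (A' y h - A0 h)" "B' y h"] \<alpha> by simp
        also have "\<dots> \<le> (1 / \<alpha>) * (\<sigma> / 4 * norm h) + M * norm h"
          using \<alpha> by (intro add_mono mult_left_mono r B'_le y) auto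
        also have "M \<le> \<sigma> / (4 * \<alpha>)"
          using \<alpha> M by (simp add: \<alpha>1_def field_simps)
        then have "(1 / \<alpha>) * (\<sigma> / 4 * norm h) + M * norm h \<le> (1 / \<alpha>) * (\<sigma> / 4 * norm h) + \<sigma> / (4 * \<alpha>) * norm h"
          by (intro add_left_mono mult_right_mono) auto
        also have "\<dots> = \<sigma> / (2 * \<alpha>) * norm h" using \<alpha> by (simp add: field_simps)
        finally show ?thesis .
      qed
      moreover have "adjoint (\<lambda>h. (1 / \<alpha>) *\<^sub>R A0 h) u = (1 / \<alpha>) *\<^sub>R adjoint A0 u"
        unfolding adjoint_eq_sum_Basis[OF linA0'] adjoint_eq_sum_Basis[OF linA0]
        by (simp add: scaleR_sum_right)
      then have "\<sigma> / \<alpha> * norm u \<le> norm (adjoint (\<lambda>h. (1 / \<alpha>) *\<^sub>R A0 h) u)"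
        using lower[of u] \<alpha> by (simp add: field_simps)
      ultimately have "(\<sigma> / \<alpha> - \<sigma> / (2 * \<alpha>)) * norm u \<le> norm (adjoint (G' y) u)"
        using adjoint_lower_bound_perturb[OF lin linA0'] by blast
      also have "\<sigma> / \<alpha> - \<sigma> / (2 * \<alpha>) = \<sigma> / (2 * \<alpha>)" using \<alpha> by (simp add: field_simps)
      finally show "\<sigma> / (2 * \<alpha>) * norm u \<le> norm (adjoint (G' y) u)" .
      have "norm (G' y h) \<le> N / \<alpha> * norm h" for h
      proof -
        have "norm (G' y h) \<le> (1 / \<alpha>) * norm (A' y h) + norm (B' y h)"
          using norm_triangle_ineq[of "(1 / \<alpha>) *\<^sub>R A' y h" "B' y h"] \<alpha> by (simp add: G'_def)
        also have "\<dots> \<le> (1 / \<alpha>) * (NA * norm h) + M * norm h"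
          using \<alpha> by (intro add_mono mult_left_mono NA B'_le y) auto
        also have "M \<le> M / \<alpha>" using \<alpha> M by (simp add: field_simps)
        then have "(1 / \<alpha>) * (NA * norm h) + M * norm h \<le> (1 / \<alpha>) * (NA * norm h) + M / \<alpha> * norm h"
          by (intro add_left_mono mult_right_mono) auto
        also have "\<dots> = N / \<alpha> * norm h" using \<alpha> by (simp add: N_def field_simps)
        finally show ?thesis .
      qed
      then show "norm (adjoint (G' y) u) \<le> N / \<alpha> * norm u"
        by (rule norm_adjoint_le[OF lin])
    next
      have "N / \<alpha> * K / (\<sigma> / (2 * \<alpha>))\<^sup>2 = 4 * N * K * \<alpha> / \<sigma>\<^sup>2"
        using \<alpha> \<sigma> by (simp add: field_simps power2_eq_square)
      also have "\<dots> \<le> 4 * N * K * (r * \<sigma>\<^sup>2 / (8 * N * K)) / \<sigma>\<^sup>2"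
        using \<alpha> N K \<sigma> by (intro divide_right_mono mult_left_mono) (auto simp: \<alpha>1_def)
      also have "\<dots> = r / 2" using N K \<sigma> by simp
      also have "\<dots> < r" using r(1) by simp
      finally show "N / \<alpha> * K / (\<sigma> / (2 * \<alpha>))\<^sup>2 < r" .
    qed (use derivG r(1) \<sigma> \<alpha> N K startK in auto)
    have grad: "((\<lambda>y. (norm (G y))\<^sup>2) has_derivative (\<lambda>h. (2 *\<^sub>R adjoint (G' y) (G y)) \<bullet> h)) (at y)" for y
      by (rule has_derivative_norm_squared[OF derivG])
    show "(\<exists>\<gamma>. neg_grad_flow (\<lambda>y. (norm (G y))\<^sup>2) y0 \<gamma>) \<and>
      (\<forall>\<gamma>. neg_grad_flow (\<lambda>y. (norm (G y))\<^sup>2) y0 \<gamma> \<longrightarrow>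
         (\<exists>ys. G ys = 0 \<and> ys \<in> cball y0 r \<and> (\<gamma> \<longlongrightarrow> ys) at_top))"
    proof (intro conjI allI impI)
      obtain \<gamma> where "\<gamma> 0 = y0"
        "\<And>t. t \<ge> 0 \<Longrightarrow> (\<gamma> has_vector_derivative - (2 *\<^sub>R adjoint (G' (\<gamma> t)) (G (\<gamma> t)))) (at t within {0..})"
        using CkG by (rule flow_exists) (rule that)
      then have "neg_grad_flow (\<lambda>y. (norm (G y))\<^sup>2) y0 \<gamma>"
        unfolding neg_grad_flow_def using grad by blast
      then show "\<exists>\<gamma>. neg_grad_flow (\<lambda>y. (norm (G y))\<^sup>2) y0 \<gamma>" by blast
    next
      fix \<gamma> assume flow: "neg_grad_flow (\<lambda>y. (norm (G y))\<^sup>2) y0 \<gamma>"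
      have init: "\<gamma> 0 = y0" using flow by (simp add: neg_grad_flow_def)
      have vd: "(\<gamma> has_vector_derivative - (2 *\<^sub>R adjoint (G' (\<gamma> t)) (G (\<gamma> t)))) (at t within {0..})"
        if t: "t \<ge> 0" for t
      proof -
        obtain g where g: "((\<lambda>y. (norm (G y))\<^sup>2) has_derivative (\<lambda>h. g \<bullet> h)) (at (\<gamma> t))"
            "(\<gamma> has_vector_derivative (- g)) (at t within {0..})"
          using flow t unfolding neg_grad_flow_def by blast
        \<comment> \<open>A flow only comes with some vector representing the derivative; uniqueness
          of the derivative identifies it with the explicit gradient.\<close>
        have "(\<lambda>h. g \<bullet> h) = (\<lambda>h. (2 *\<^sub>R adjoint (G' (\<gamma> t)) (G (\<gamma> t))) \<bullet> h)"
          by (rule has_derivative_unique[OF g(1) grad])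
        then have "g = 2 *\<^sub>R adjoint (G' (\<gamma> t)) (G (\<gamma> t))"
          by (metis vector_eq_rdot inner_commute)
        with g(2) show ?thesis by simp
      qed
      have cont: "continuous_on {0..} \<gamma>"
        unfolding continuous_on_eq_continuous_within
        using vd has_vector_derivative_continuous by fastforce
      have vd': "(\<gamma> has_vector_derivative - (2 *\<^sub>R adjoint (G' (\<gamma> t)) (G (\<gamma> t)))) (at t)" if "t > 0" for t
        using vd[of t] that by (simp add: at_within_Ici_eq_at)
      show "\<exists>ys. G ys = 0 \<and> ys \<in> cball y0 r \<and> (\<gamma> \<longlongrightarrow> ys) at_top"
        by (rule converges_to_zero[of \<gamma>, OF init cont vd']) auto
    qed
  qed
qed

section \<open>Kinematics\<close>

lemma sigma_min_le_norm:
  "sigma_min M * norm u \<le> norm (M *v u)"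
proof (cases "u = 0")
  case False
  define v where "v = (1 / norm u) *\<^sub>R u"
  have "norm v = 1" using False by (simp add: v_def)
  then have "sigma_min M \<le> norm (M *v v)"
    unfolding sigma_min_def by (intro cInf_lower bdd_belowI[of _ 0]) auto
  also have "M *v v = (1 / norm u) *\<^sub>R (M *v u)"
    by (simp add: v_def matrix_vector_mult_scaleR)
  finally show ?thesis using False by (simp add: field_simps)
qed simp

lemma integral_matrix_vector_mult:
  fixes F :: "'a::euclidean_space \<Rightarrow> real^'n^'m"
  assumes "F integrable_on R"
  shows "integral R (\<lambda>x. F x *v h) = integral R F *v h"
proof -
  have "bounded_linear (\<lambda>M :: real^'n^'m. M *v h)"
    unfolding linear_conv_bounded_linear[symmetric]
    by (rule linearI) (simp_all add: matrix_vector_mult_add_rdistrib scaleR_matrix_vector_assoc)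
  from integral_linear[OF assms this] show ?thesis by (simp add: o_def)
qed

lemma transpose_integral:
  fixes F :: "'a::euclidean_space \<Rightarrow> real^'n^'m"
  assumes "F integrable_on R"
  shows "transpose (integral R F) = integral R (\<lambda>x. transpose (F x))"
proof -
  have "bounded_linear (transpose :: real^'n^'m \<Rightarrow> _)"
    unfolding linear_conv_bounded_linear[symmetric]
    by (rule linearI) (simp_all add: transpose_def vec_eq_iff)
  from integral_linear[OF assms this] show ?thesis by (simp add: o_def)
qed

text \<open>Symmetry is what converts the singular value bound for the Gram matrix into the bound
  for the adjoint that the flow argument uses.\<close>

lemma transpose_scaleR_gram:
  "transpose (c *\<^sub>R (transpose M ** M)) = c *\<^sub>R (transpose M ** (M :: real^'n^'m))"
  by (simp add: transpose_def vec_eq_iff matrix_matrix_mult_def mult.commute)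

text \<open>The Jacobian in the configuration is the joint derivative in directions
  \<open>(0, h)\<close>, and its transpose is the corresponding adjoint. Both thus inherit
  regularity from joint smoothness in \<open>(x, th)\<close>.\<close>

lemma
  assumes "\<And>p. ((\<lambda>p. X (fst p) (snd p)) has_derivative X' p) (at p)"
  shows dXdth_mult_vec: "dXdth X x th *v h = X' (x, th) (0, h)"
    and transpose_dXdth_mult_vec:
      "transpose (dXdth X x th) *v y = (\<Sum>b\<in>Basis. (X' (x, th) (0, b) \<bullet> y) *\<^sub>R b)"
proof -
  have d: "(X x has_derivative (\<lambda>h. X' (x, th) (0, h))) (at th)"
    using has_derivative_slice[OF assms] by simp
  have lin: "linear (\<lambda>h. X' (x, th) (0, h))" using d by (rule has_derivative_linear)
  have mult: "dXdth X x th *v h = X' (x, th) (0, h)" for h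
    unfolding dXdth_def jacobian_def frechet_derivative_at[OF d, symmetric]
    by (rule fun_cong[OF matrix_vector_mul(2)[OF lin]])
  then show "dXdth X x th *v h = X' (x, th) (0, h)" .
  have "transpose (dXdth X x th) *v y = adjoint (\<lambda>h. X' (x, th) (0, h)) y"
    using adjoint_matrix[of "dXdth X x th"] by (simp add: mult del: transpose_matrix_vector)
  then show "transpose (dXdth X x th) *v y = (\<Sum>b\<in>Basis. (X' (x, th) (0, b) \<bullet> y) *\<^sub>R b)"
    using adjoint_eq_sum_Basis[OF lin] by simp
qed

theorem theorem3:
  fixes R C :: "(real^3) set" and \<rho> dt \<sigma>X :: real
    and X :: "real^3 \<Rightarrow> real^'n \<Rightarrow> real^3"
    and V :: "real^3 \<Rightarrow> nat" and vcol :: "real^3 \<Rightarrow> nat \<Rightarrow> real^'n \<Rightarrow> real^3"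
    and thp thpp \<tau> :: "real^'n"
  assumes R_bounded: "bounded R" and R_meas: "R \<in> sets lebesgue"
    and rho_pos: "\<rho> > 0" and dt_pos: "dt > 0"
    and C_fin: "finite C" and C_sub: "C \<subseteq> R"
    and A1: "smooth (\<lambda>p :: (real^3) \<times> (real^'n). X (fst p) (snd p))"
    and A2: "sigma_min (integral R (\<lambda>x. (\<rho> / dt^2) *\<^sub>R
                 (transpose (dXdth X x thp) ** dXdth X x thp))) \<ge> \<sigma>X"
    and sigX_pos: "\<sigma>X > 0"
    and A3: "\<forall>x\<in>C. \<forall>j<V x. Ck 3 (vcol x j)"
  shows "\<exists>r>0. \<exists>\<alpha>1>0. \<forall>\<alpha> w. 0 < \<alpha> \<and> \<alpha> \<le> 1 \<and> \<alpha> \<le> \<alpha>1 \<and> feasible C V w \<longrightarrow>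
     (let Va = (\<lambda>th. (norm (Gop \<alpha> R \<rho> dt X thp thpp C V vcol \<tau> th w))^2) in
       (\<exists>\<gamma>. neg_grad_flow Va thp \<gamma>) \<and>
       (\<forall>\<gamma>. neg_grad_flow Va thp \<gamma> \<longrightarrow>
          (\<exists>ths. Gop \<alpha> R \<rho> dt X thp thpp C V vcol \<tau> ths w = 0 \<and> ths \<in> cball thp r
                 \<and> (\<gamma> \<longlongrightarrow> ths) at_top)))"
proof -
  define \<kappa> where "\<kappa> = \<rho> / dt\<^sup>2"
  define f where "f p = X (fst p) (snd p)" for p
  have Ckf: "Ck k f" for k using A1 by (simp add: smooth_def f_def[abs_def])
  obtain f' where f': "\<And>p. (f has_derivative f' p) (at p)"
    using Ckf[of "Suc 0"] by (rule Ck_SucE) (rule that)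
  have Ckf': "Ck k (\<lambda>p. f' p h)" for k h
    using Ckf f' by (rule Ck_SucD)
  have X': "((\<lambda>p. X (fst p) (snd p)) has_derivative f' p) (at p)" for p
    using f' by (simp add: f_def[abs_def])
  have Ck_at: "Ck k (\<lambda>p :: (real^3) \<times> (real^'n). f (fst p, a))" for k a
  proof -
    have "bounded_linear (\<lambda>p :: (real^3) \<times> (real^'n). (fst p, 0 :: real^'n))"
      by (intro bounded_linear_Pair bounded_linear_fst bounded_linear_zero)
    from Ck_compose_affine[OF this Ckf, of k "(0, a)"] show ?thesis by simp
  qed
  define J where "J p y = (\<Sum>b\<in>Basis. (f' p (0, b) \<bullet> y) *\<^sub>R b)" for p y
  have J: "transpose (dXdth X x th) *v y = J (x, th) y" for x th y
    unfolding J_def by (rule transpose_dXdth_mult_vec[OF X'])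
  have CkJ: "Ck k (\<lambda>p. J p (g p))" if "Ck k g" for k g
    unfolding J_def by (intro Ck_sum Ck_scaleR Ck_inner Ckf' Ck_const that)

  define \<phi> where "\<phi> p = \<kappa> *\<^sub>R J p (f p - f (fst p, thp))" for p
  have Ck\<phi>: "Ck k \<phi>" for k
    unfolding \<phi>_def by (intro Ck_scaleR CkJ Ck_const Ck_diff Ckf Ck_at)
  have Aop_eq: "Aop R \<rho> dt X thp = (\<lambda>th. integral R (\<lambda>x. \<phi> (x, th)))"
    by (simp add: fun_eq_iff Aop_def \<phi>_def J \<kappa>_def f_def del: transpose_matrix_vector)
  define \<psi> where "\<psi> p = \<kappa> *\<^sub>R J p (f (fst p, thpp) - f (fst p, thp))" for p
  have Ck\<psi>: "Ck k \<psi>" for k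
    unfolding \<psi>_def by (intro Ck_scaleR CkJ Ck_const Ck_diff Ck_at)
  define b where "b th = integral R (\<lambda>x. \<psi> (x, th)) - \<tau>" for th
  \<comment> \<open>One index per contact point and column of its matrix, hence one scalar weight
    per index.\<close>
  define I where "I = Sigma C (\<lambda>x. {..<V x})"
  \<comment> \<open>The factor \<open>-1\<close> absorbs the minus sign of the contact sum in
    \<open>Bop\<close>.\<close>
  define c where "c k th = (-1) *\<^sub>R J (fst k, th) (vcol (fst k) (snd k) th)" for k th

  have Ckc: "Ck 2 (c k)" if k: "k \<in> I" for k
  proof -
    have "bounded_linear (\<lambda>th :: real^'n. (0 :: real^3, th))"
      by (intro bounded_linear_Pair bounded_linear_zero bounded_linear_ident)
    from Ck_compose_affine[OF this Ckf', of 2 "(fst k, 0)"]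
    have "Ck 2 (\<lambda>th. f' (fst k, th) h)" for h by simp
    moreover have "Ck 2 (vcol (fst k) (snd k))"
      using A3 k by (auto simp: I_def intro: Ck_mono[of 3])
    ultimately show ?thesis
      unfolding c_def J_def by (intro Ck_sum Ck_scaleR Ck_inner Ck_const)
  qed

  define Mx where "Mx x = \<kappa> *\<^sub>R (transpose (dXdth X x thp) ** dXdth X x thp)" for x
  have Mx_vec: "Mx x *v h = \<kappa> *\<^sub>R J (x, thp) (f' (x, thp) (0, h))" for x h
    by (simp add: Mx_def scaleR_matrix_vector_assoc[symmetric] matrix_vector_mul_assoc[symmetric]
        dXdth_mult_vec[OF X'] J del: transpose_matrix_vector)
  \<comment> \<open>Smoothness gives continuity of \<open>Mx x *v h\<close> for each
    \<open>h\<close>; entries are recovered through basis vectors and reassembled into a continuous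
    matrix.\<close>
  have "Mx x $ i $ j = (Mx x *v axis j 1) $ i" for x i j
    by (simp add: matrix_vector_mult_basis column_def)
  moreover have "continuous_on UNIV (\<lambda>x. Mx x *v h)" for h
    unfolding Mx_vec J_def
    by (intro continuous_intros continuous_on_slice Ck_imp_continuous_on[OF Ckf'])
  ultimately have "continuous_on UNIV (\<lambda>x. Mx x $ i $ j)" for i j
    by (simp add: continuous_on_component)
  then have "continuous_on UNIV (\<lambda>x. \<chi> i j. Mx x $ i $ j)"
    by (intro continuous_on_vec_lambda)
  then have "continuous_on UNIV Mx" by simp
  then have Mx_int: "Mx integrable_on R"
    by (rule integrable_on_bounded_continuous[OF R_bounded R_meas])

  define A0 where "A0 h = integral R Mx *v h" for h
  have A0: "(Aop R \<rho> dt X thp has_derivative A0) (at thp)"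
  proof -
    obtain \<phi>' where \<phi>': "\<And>p. (\<phi> has_derivative \<phi>' p) (at p)" "\<And>h. Ck 0 (\<lambda>p. \<phi>' p h)"
      using Ck\<phi>[of "Suc 0"] by (rule Ck_SucE) (rule that)
    \<comment> \<open>In the product rule, the term that differentiates the transposed Jacobian
      carries the factor \<open>f (x, thp) - f (x, thp) = 0\<close>. Only the Gram term is
      left.\<close>
    have "\<phi>' (x, thp) (0, h) = Mx x *v h" for x h
    proof -
      have "\<exists>D. ((\<lambda>th. f' (x, th) (0, e)) has_derivative D) (at thp)" for e
        using Ckf'[of "Suc 0" "(0, e)"]
        by (rule Ck_SucE) (rule exI, erule meta_allE, erule has_derivative_slice)
      then obtain D where D: "\<And>e. ((\<lambda>th. f' (x, th) (0, e)) has_derivative D e) (at thp)"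
        by metis
      have "((\<lambda>th. f (x, th) - f (x, thp)) has_derivative (\<lambda>h. f' (x, thp) (0, h) - 0)) (at thp)"
        by (rule has_derivative_diff[OF has_derivative_slice[OF f'] has_derivative_const])
      then have "((\<lambda>th. \<phi> (x, th)) has_derivative (\<lambda>h. \<kappa> *\<^sub>R (\<Sum>b\<in>Basis.
          (f' (x, thp) (0, b) \<bullet> (f' (x, thp) (0, h) - 0) + D b h \<bullet> (f (x, thp) - f (x, thp))) *\<^sub>R b))) (at thp)"
        unfolding \<phi>_def J_def fst_conv
        by (intro has_derivative_scaleR_right has_derivative_sum has_derivative_scaleR_left
            has_derivative_inner D)
      from has_derivative_unique[OF has_derivative_slice[OF \<phi>'(1)] this]
      show ?thesis by (simp add: Mx_vec J_def fun_eq_iff)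
    qed
    then have "integral R (\<lambda>x. \<phi>' (x, thp) (0, h)) = A0 h" for h
      by (simp add: A0_def integral_matrix_vector_mult[OF Mx_int])
    moreover have "continuous_on UNIV (\<lambda>p. \<phi>' p h)" for h
      using \<phi>'(2) by simp
    ultimately show ?thesis
      using has_derivative_parametric_integral[OF R_bounded R_meas \<phi>'(1), of thp]
      unfolding Aop_eq by simp
  qed
  have "transpose (integral R Mx) = integral R Mx"
    unfolding transpose_integral[OF Mx_int] unfolding Mx_def transpose_scaleR_gram ..
  then have "adjoint A0 u = integral R Mx *v u" for u
    using adjoint_matrix[of "integral R Mx"] by (simp add: A0_def[abs_def] del: transpose_matrix_vector)
  moreover have "\<sigma>X \<le> sigma_min (integral R Mx)"
    using A2 by (simp add: Mx_def[abs_def] \<kappa>_def)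
  ultimately have lower: "\<sigma>X * norm u \<le> norm (adjoint A0 u)" for u
    using sigma_min_le_norm[of "integral R Mx" u] mult_right_mono[of \<sigma>X _ "norm u"]
    by (metis norm_ge_zero order_trans)

  have CkA: "Ck 2 (Aop R \<rho> dt X thp)"
    unfolding Aop_eq by (rule Ck_parametric_integral[OF R_bounded R_meas Ck\<phi>])
  have Ckb: "Ck 2 b"
    unfolding b_def by (intro Ck_diff Ck_const Ck_parametric_integral[OF R_bounded R_meas Ck\<psi>])
  have A_thp: "Aop R \<rho> dt X thp thp = 0" by (simp add: Aop_def)
  have finI: "finite I" using C_fin by (simp add: I_def)
  have G_eq: "Gop \<alpha> R \<rho> dt X thp thpp C V vcol \<tau> th w =
      (1 / \<alpha>) *\<^sub>R Aop R \<rho> dt X thp th + (b th + (\<Sum>k\<in>I. w (fst k) (snd k) *\<^sub>R c k th))" for \<alpha> th w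
  proof -
    \<comment> \<open>Linearity pulls the weights out, and the double sum over contact points and
      columns is flattened to a sum over \<open>I\<close>.\<close>
    have "(\<Sum>x\<in>C. transpose (dXdth X x th) *v (\<Sum>j<V x. w x j *\<^sub>R vcol x j th))
        = (\<Sum>x\<in>C. \<Sum>j<V x. - (w x j *\<^sub>R c (x, j) th))"
      by (simp add: vec.sum matrix_vector_mult_scaleR J c_def del: transpose_matrix_vector)
    also have "\<dots> = - (\<Sum>k\<in>I. w (fst k) (snd k) *\<^sub>R c k th)"
      unfolding I_def using C_fin by (subst sum.Sigma) (auto simp: sum_negf split_beta)
    finally show ?thesis
      by (simp add: Gop_def Bop_def b_def \<psi>_def J \<kappa>_def f_def del: transpose_matrix_vector)
  qed
  have feas: "\<forall>k\<in>I. \<bar>w (fst k) (snd k)\<bar> \<le> 1" if w: "feasible C V w" for w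
  proof
    fix k assume "k \<in> I"
    then obtain x j where k: "k = (x, j)" "x \<in> C" "j < V x" by (auto simp: I_def)
    \<comment> \<open>Each weight is nonnegative and bounded by the total of its contact point,
      hence lies in \<open>[0, 1]\<close>.\<close>
    then have "w x j \<le> (\<Sum>j<V x. w x j)" "(\<Sum>j<V x. w x j) \<le> 1" "0 \<le> w x j"
      using w by (auto simp: feasible_def intro!: member_le_sum)
    then show "\<bar>w (fst k) (snd k)\<bar> \<le> 1" by (simp add: k)
  qed
  show ?thesis
  proof (rule penalized_gradient_flow_converges[of I _ b c, OF finI CkA Ckb _ A_thp A0 lower sigX_pos])
    show "Ck 2 (c k)" if "k \<in> I" for k using that by (rule Ckc)
    fix r \<alpha>1 :: real
    assume "r > 0" "\<alpha>1 > 0" and main: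
      "\<And>\<alpha> w G. \<lbrakk>0 < \<alpha>; \<alpha> \<le> 1; \<alpha> \<le> \<alpha>1; \<forall>k\<in>I. \<bar>w k\<bar> \<le> 1;
        \<And>y. G y = (1 / \<alpha>) *\<^sub>R Aop R \<rho> dt X thp y + (b y + (\<Sum>k\<in>I. w k *\<^sub>R c k y))\<rbrakk> \<Longrightarrow>
      (\<exists>\<gamma>. neg_grad_flow (\<lambda>y. (norm (G y))\<^sup>2) thp \<gamma>) \<and>
      (\<forall>\<gamma>. neg_grad_flow (\<lambda>y. (norm (G y))\<^sup>2) thp \<gamma> \<longrightarrow>
         (\<exists>ys. G ys = 0 \<and> ys \<in> cball thp r \<and> (\<gamma> \<longlongrightarrow> ys) at_top))"
    show ?thesis
      unfolding Let_def
    proof (rule exI[of _ r], rule conjI[OF \<open>r > 0\<close>], rule exI[of _ \<alpha>1], rule conjI[OF \<open>\<alpha>1 > 0\<close>],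
        intro allI impI)
      fix \<alpha> :: real and w
      assume "0 < \<alpha> \<and> \<alpha> \<le> 1 \<and> \<alpha> \<le> \<alpha>1 \<and> feasible C V w"
      then show "(\<exists>\<gamma>. neg_grad_flow (\<lambda>th. (norm (Gop \<alpha> R \<rho> dt X thp thpp C V vcol \<tau> th w))\<^sup>2) thp \<gamma>) \<and>
         (\<forall>\<gamma>. neg_grad_flow (\<lambda>th. (norm (Gop \<alpha> R \<rho> dt X thp thpp C V vcol \<tau> th w))\<^sup>2) thp \<gamma> \<longrightarrow>
            (\<exists>ths. Gop \<alpha> R \<rho> dt X thp thpp C V vcol \<tau> ths w = 0 \<and> ths \<in> cball thp r
                   \<and> (\<gamma> \<longlongrightarrow> ths) at_top))"
        by (intro main[of \<alpha> "\<lambda>k. w (fst k) (snd k)"] feas G_eq) simp_all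
    qed
  qed
qed

end
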